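(* Let $n\ge1$. (1) $\mathbf{M}^+\mathbf{GrzB}$ axiomatizes the one-variable fragment of $\mathbf{Q}^+\mathbf{GrzB}$. (2) $\mathbf{MGLB}$ axiomatizes the one-variable fragment of $\mathbf{QGLB}$. (3) $\mathbf{M}^+\mathbf{GrzB}[n]$ axiomatizes the one-variable fragment of $\mathbf{Q}^+\mathbf{GrzB}[n]$. (4) $\mathbf{MGLB}[n]$ axiomatizes the one-variable fragment of $\mathbf{QGLB}[n]$.
   Context: Propositional side. $\mathcal{L}_{\Diamond\exists}$ is the propositional language with two modalities $\Diamond,\exists$, with $\Box=\neg\Diamond\neg$ and $\forall=\neg\exists\neg$. $\mathbf{GL}=\mathbf{K}+\Box(\Box p\to p)\to\Box p$ and $\mathbf{Grz}=\mathbf{K}+\Box(\Box(p\to\Box p)\to p)\to p$ (in modality $\Diamond$), and $\mathbf{S5}$ is formulated in modality $\exists$. For a unimodal logic $\mathbf{L}$, the fusion $\mathbf{L}\otimes\mathbf{S5}$ is the least set of $\mathcal{L}_{\Diamond\exists}$-formulae containing the theorems of $\mathbf{L}$ and of $\mathbf{S5}$ and closed under Modus Ponens, Substitution, $\Box$-necessitation, and $\forall$-necessitation; "$+$" denotes the least extension containing the given formulae and closed under the same rules. Put $\mathbf{MLB}=(\mathbf{L}\otimes\mathbf{S5})+(\exists\Diamond p\to\Diamond\exists p)+(\Diamond\exists p\to\exists\Diamond p)$ (giving $\mathbf{MGLB}$, $\mathbf{MGrzB}$), and $\mathbf{M}^+\mathbf{GrzB}=\mathbf{MGrzB}+\Box\forall(\Box(\Box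 p\to\Box\forall p)\to\Box\forall p)\to\Box\forall p$. Let $bd_1=\Diamond\Box p_1\to p_1$ and $bd_n=\Diamond(\Box p_n\wedge\neg bd_{n-1})\to p_n$ for $n\ge2$. For any logic $\mathbf{N}$ (propositional or predicate), $\mathbf{N}[n]$ is the extension of $\mathbf{N}$ by $bd_n$. Predicate side. A predicate modal logic is a set of first-order modal formulae (in a language with predicate letters of all finite arities, without function symbols, individual constants or equality) containing classical predicate logic and the axiom $\mathbf{K}$ and closed under Modus Ponens, generalization, $\Box$-necessitation, and substitution of formulae for predicate letters. For a propositional modal logic $\mathbf{L}$, $\mathbf{QLB}$ is the least predicate modal logic containing $\mathbf{L}$ and the Barcan formula $\Diamond\exists x\,P(x)\to\exists x\,\Diamond P(x)$. $\mathbf{Q}^+\mathbf{GrzB}$ is obtained by adding to $\mathbf{QGrzB}$ the Gödel translation of Casari's formula $\forall x((P(x)\to\forall xP(x))\to\forall xP(x))\to\forall xP(x)$, equivalently the formula $\Box\forall x(\Box(\Box P(x)\to\Box\forall xP(x))\to\Box\forall xP(x))\to\Box\forall xP(x)$. Fragments. Fix an individual variable $x$ and assign to each propositional letter $p$ a distinct unary predicate letter $P$. The translation $\varphi\mapsto\varphi^t$ from $\mathcal{L}_{\Diamond\exists}$-formulae to monadic predicate modal formulae is given by $p^t=P(x)$, commutes with Boolean connectives and $\Diamond$, and $(\exists\psi)^t=\exists x\,\psi^t$. A logic $\mathbf{M}$ in $\mathcal{L}_{\Diamond\exists}$ axiomatizes the one-variable fragment of a predicate modal logic $\mathbf{Q}$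 if for every $\mathcal{L}_{\Diamond\exists}$-formula $\varphi$: $\varphi\in\mathbf{M}\iff\varphi^t\in\mathbf{Q}$. *)

theory Defs
  imports Main
begin

section \<open>Propositional unimodal logics\<close>

datatype ufm =
    UVar nat
  | UBot
  | UImp ufm ufm  (infixr \<open>\<rightarrow>\<^sub>U\<close> 55)
  | UDia ufm

abbreviation UNot :: "ufm \<Rightarrow> ufm" where "UNot \<phi> \<equiv> \<phi> \<rightarrow>\<^sub>U UBot"
abbreviation UAnd :: "ufm \<Rightarrow> ufm \<Rightarrow> ufm"  (infixr \<open>\<and>\<^sub>U\<close> 60)
  where "\<phi> \<and>\<^sub>U \<psi> \<equiv> UNot (\<phi> \<rightarrow>\<^sub>U UNot \<psi>)"
abbreviation UIff :: "ufm \<Rightarrow> ufm \<Rightarrow> ufm"  (infix \<open>\<leftrightarrow>\<^sub>U\<close> 54)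
  where "\<phi> \<leftrightarrow>\<^sub>U \<psi> \<equiv> (\<phi> \<rightarrow>\<^sub>U \<psi>) \<and>\<^sub>U (\<psi> \<rightarrow>\<^sub>U \<phi>)"
abbreviation UBox :: "ufm \<Rightarrow> ufm" where "UBox \<phi> \<equiv> UNot (UDia (UNot \<phi>))"

primrec usubst :: "(nat \<Rightarrow> ufm) \<Rightarrow> ufm \<Rightarrow> ufm" where
  "usubst s (UVar i) = s i"
| "usubst s UBot = UBot"
| "usubst s (\<phi> \<rightarrow>\<^sub>U \<psi>) = usubst s \<phi> \<rightarrow>\<^sub>U usubst s \<psi>"
| "usubst s (UDia \<phi>) = UDia (usubst s \<phi>)"

text \<open>Truth tables: every formula that is not \<open>\<bottom>\<close> or an implication is treated as an atom.\<close>

fun utruth :: "(ufm \<Rightarrow> bool) \<Rightarrow> ufm \<Rightarrow> bool" where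
  "utruth v UBot = False"
| "utruth v (\<phi> \<rightarrow>\<^sub>U \<psi>) = (utruth v \<phi> \<longrightarrow> utruth v \<psi>)"
| "utruth v \<phi> = v \<phi>"

definition utautology :: "ufm \<Rightarrow> bool" where
  "utautology \<phi> \<longleftrightarrow> (\<forall>v. utruth v \<phi>)"

definition ax_K :: ufm where
  "ax_K = UBox (UVar 0 \<rightarrow>\<^sub>U UVar 1) \<rightarrow>\<^sub>U (UBox (UVar 0) \<rightarrow>\<^sub>U UBox (UVar 1))"

text \<open>Since \<open>\<diamond>\<close> is primitive and \<open>\<box>\<close> abbreviates \<open>\<not>\<diamond>\<not>\<close>, the system \<open>K\<close> needs the duality axiom
  besides the distribution axiom for \<open>\<box>\<close>; without it \<open>\<diamond>p\<close> and \<open>\<diamond>\<not>\<not>p\<close> would be unrelated.\<close>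

definition ax_Dual :: ufm where
  "ax_Dual = UDia (UVar 0) \<leftrightarrow>\<^sub>U UNot (UBox (UNot (UVar 0)))"

definition normal_logic :: "ufm set \<Rightarrow> bool" where
  "normal_logic L \<longleftrightarrow>
     (\<forall>\<phi>. utautology \<phi> \<longrightarrow> \<phi> \<in> L) \<and> ax_K \<in> L \<and> ax_Dual \<in> L \<and>
     (\<forall>\<phi> \<psi>. \<phi> \<rightarrow>\<^sub>U \<psi> \<in> L \<longrightarrow> \<phi> \<in> L \<longrightarrow> \<psi> \<in> L) \<and>
     (\<forall>\<phi> s. \<phi> \<in> L \<longrightarrow> usubst s \<phi> \<in> L) \<and>
     (\<forall>\<phi>. \<phi> \<in> L \<longrightarrow> UBox \<phi> \<in> L)"

definition K_plus :: "ufm set \<Rightarrow> ufm set" where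
  "K_plus \<Gamma> = \<Inter> {L. normal_logic L \<and> \<Gamma> \<subseteq> L}"

definition GL :: "ufm set" where
  "GL = K_plus {UBox (UBox (UVar 0) \<rightarrow>\<^sub>U UVar 0) \<rightarrow>\<^sub>U UBox (UVar 0)}"

definition Grz :: "ufm set" where
  "Grz = K_plus {UBox (UBox (UVar 0 \<rightarrow>\<^sub>U UBox (UVar 0)) \<rightarrow>\<^sub>U UVar 0) \<rightarrow>\<^sub>U UVar 0}"

definition S5 :: "ufm set" where
  "S5 = K_plus
     {UBox (UVar 0) \<rightarrow>\<^sub>U UVar 0,
      UBox (UVar 0) \<rightarrow>\<^sub>U UBox (UBox (UVar 0)),
      UDia (UVar 0) \<rightarrow>\<^sub>U UBox (UDia (UVar 0))}"

text \<open>The formulae \<open>bd\<^sub>n\<close> for \<open>n \<ge> 1\<close>; the value at \<open>0\<close> is irrelevant.\<close>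

fun bd :: "nat \<Rightarrow> ufm" where
  "bd 0 = UBot"
| "bd (Suc 0) = UDia (UBox (UVar 1)) \<rightarrow>\<^sub>U UVar 1"
| "bd (Suc (Suc n)) =
     UDia (UBox (UVar (Suc (Suc n))) \<and>\<^sub>U UNot (bd (Suc n))) \<rightarrow>\<^sub>U UVar (Suc (Suc n))"


section \<open>Monadic (bimodal) logics\<close>

datatype bfm =
    BVar nat
  | BBot
  | BImp bfm bfm  (infixr \<open>\<rightarrow>\<^sub>B\<close> 55)
  | BDia bfm
  | BEx bfm

abbreviation BNot :: "bfm \<Rightarrow> bfm" where "BNot \<phi> \<equiv> \<phi> \<rightarrow>\<^sub>B BBot"
abbreviation BBox :: "bfm \<Rightarrow> bfm" where "BBox \<phi> \<equiv> BNot (BDia (BNot \<phi>))"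
abbreviation BAll :: "bfm \<Rightarrow> bfm" where "BAll \<phi> \<equiv> BNot (BEx (BNot \<phi>))"

primrec bsubst :: "(nat \<Rightarrow> bfm) \<Rightarrow> bfm \<Rightarrow> bfm" where
  "bsubst s (BVar i) = s i"
| "bsubst s BBot = BBot"
| "bsubst s (\<phi> \<rightarrow>\<^sub>B \<psi>) = bsubst s \<phi> \<rightarrow>\<^sub>B bsubst s \<psi>"
| "bsubst s (BDia \<phi>) = BDia (bsubst s \<phi>)"
| "bsubst s (BEx \<phi>) = BEx (bsubst s \<phi>)"

primrec in_dia :: "ufm \<Rightarrow> bfm" where
  "in_dia (UVar i) = BVar i"
| "in_dia UBot = BBot"
| "in_dia (\<phi> \<rightarrow>\<^sub>U \<psi>) = in_dia \<phi> \<rightarrow>\<^sub>B in_dia \<psi>"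
| "in_dia (UDia \<phi>) = BDia (in_dia \<phi>)"

primrec in_ex :: "ufm \<Rightarrow> bfm" where
  "in_ex (UVar i) = BVar i"
| "in_ex UBot = BBot"
| "in_ex (\<phi> \<rightarrow>\<^sub>U \<psi>) = in_ex \<phi> \<rightarrow>\<^sub>B in_ex \<psi>"
| "in_ex (UDia \<phi>) = BEx (in_ex \<phi>)"

definition bclosed :: "bfm set \<Rightarrow> bool" where
  "bclosed M \<longleftrightarrow>
     (\<forall>\<phi> \<psi>. \<phi> \<rightarrow>\<^sub>B \<psi> \<in> M \<longrightarrow> \<phi> \<in> M \<longrightarrow> \<psi> \<in> M) \<and>
     (\<forall>\<phi> s. \<phi> \<in> M \<longrightarrow> bsubst s \<phi> \<in> M) \<and>
     (\<forall>\<phi>. \<phi> \<in> M \<longrightarrow> BBox \<phi> \<in> M) \<and>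
     (\<forall>\<phi>. \<phi> \<in> M \<longrightarrow> BAll \<phi> \<in> M)"

definition fusion_S5 :: "ufm set \<Rightarrow> bfm set" where
  "fusion_S5 L = \<Inter> {M. bclosed M \<and> in_dia ` L \<subseteq> M \<and> in_ex ` S5 \<subseteq> M}"

definition bplus :: "bfm set \<Rightarrow> bfm set \<Rightarrow> bfm set" where
  "bplus M \<Gamma> = \<Inter> {N. bclosed N \<and> M \<subseteq> N \<and> \<Gamma> \<subseteq> N}"

definition MLB :: "ufm set \<Rightarrow> bfm set" where
  "MLB L = bplus (fusion_S5 L)
     {BEx (BDia (BVar 0)) \<rightarrow>\<^sub>B BDia (BEx (BVar 0)),
      BDia (BEx (BVar 0)) \<rightarrow>\<^sub>B BEx (BDia (BVar 0))}"

definition MGLB :: "bfm set" where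
  "MGLB = MLB GL"

definition MGrzB :: "bfm set" where
  "MGrzB = MLB Grz"

definition MpGrzB :: "bfm set" where
  "MpGrzB = bplus MGrzB
     {BBox (BAll (BBox (BBox (BVar 0) \<rightarrow>\<^sub>B BBox (BAll (BVar 0))) \<rightarrow>\<^sub>B BBox (BAll (BVar 0))))
        \<rightarrow>\<^sub>B BBox (BAll (BVar 0))}"

definition bdepth :: "bfm set \<Rightarrow> nat \<Rightarrow> bfm set" where
  "bdepth M n = bplus M {in_dia (bd n)}"


section \<open>Predicate modal logics\<close>

type_synonym var = nat

text \<open>In \<open>Pr P zs\<close> the predicate letter is the pair of the index \<open>P\<close> and the arity \<open>length zs\<close>, so
  \<open>Pr P [x]\<close> and \<open>Pr P []\<close> contain different letters. The letters of arity \<open>0\<close> are the propositional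
  letters.\<close>

datatype fm =
    Pr nat "var list"
  | FBot
  | FImp fm fm  (infixr \<open>\<rightarrow>\<^sub>F\<close> 55)
  | FDia fm
  | FEx var fm

abbreviation FNot :: "fm \<Rightarrow> fm" where "FNot A \<equiv> A \<rightarrow>\<^sub>F FBot"
abbreviation FAnd :: "fm \<Rightarrow> fm \<Rightarrow> fm"  (infixr \<open>\<and>\<^sub>F\<close> 60)
  where "A \<and>\<^sub>F B \<equiv> FNot (A \<rightarrow>\<^sub>F FNot B)"
abbreviation FOr :: "fm \<Rightarrow> fm \<Rightarrow> fm"  (infixr \<open>\<or>\<^sub>F\<close> 59)
  where "A \<or>\<^sub>F B \<equiv> FNot A \<rightarrow>\<^sub>F B"
abbreviation FBox :: "fm \<Rightarrow> fm" where "FBox A \<equiv> FNot (FDia (FNot A))"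
abbreviation FAll :: "var \<Rightarrow> fm \<Rightarrow> fm" where "FAll x A \<equiv> FNot (FEx x (FNot A))"

fun ftruth :: "(fm \<Rightarrow> bool) \<Rightarrow> fm \<Rightarrow> bool" where
  "ftruth v FBot = False"
| "ftruth v (A \<rightarrow>\<^sub>F B) = (ftruth v A \<longrightarrow> ftruth v B)"
| "ftruth v A = v A"

definition ftautology :: "fm \<Rightarrow> bool" where
  "ftautology A \<longleftrightarrow> (\<forall>v. ftruth v A)"

primrec fv :: "fm \<Rightarrow> var set" where
  "fv (Pr P zs) = set zs"
| "fv FBot = {}"
| "fv (A \<rightarrow>\<^sub>F B) = fv A \<union> fv B"
| "fv (FDia A) = fv A"
| "fv (FEx x A) = fv A - {x}"

text \<open>\<open>vsub s A\<close> simultaneously replaces the free occurrences of each variable \<open>z\<close> in \<open>A\<close> by \<open>s z\<close>,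
  without renaming bound variables; \<open>free_for s A\<close> says that this captures no variable.\<close>

primrec vsub :: "(var \<Rightarrow> var) \<Rightarrow> fm \<Rightarrow> fm" where
  "vsub s (Pr P zs) = Pr P (map s zs)"
| "vsub s FBot = FBot"
| "vsub s (A \<rightarrow>\<^sub>F B) = vsub s A \<rightarrow>\<^sub>F vsub s B"
| "vsub s (FDia A) = FDia (vsub s A)"
| "vsub s (FEx x A) = FEx x (vsub (s(x := x)) A)"

primrec free_for :: "(var \<Rightarrow> var) \<Rightarrow> fm \<Rightarrow> bool" where
  "free_for s (Pr P zs) \<longleftrightarrow> True"
| "free_for s FBot \<longleftrightarrow> True"
| "free_for s (A \<rightarrow>\<^sub>F B) \<longleftrightarrow> free_for s A \<and> free_for s B"
| "free_for s (FDia A) \<longleftrightarrow> free_for s A"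
| "free_for s (FEx x A) \<longleftrightarrow> (\<forall>z \<in> fv A - {x}. s z \<noteq> x) \<and> free_for (s(x := x)) A"

definition params :: "var list \<Rightarrow> var list \<Rightarrow> var \<Rightarrow> var" where
  "params xs zs v = (case map_of (zip xs zs) v of None \<Rightarrow> v | Some z \<Rightarrow> z)"

text \<open>A substitution of formulae for predicate letters assigns to the letter with index \<open>P\<close> and arity
  \<open>n\<close> a list \<open>xs\<close> of \<open>n\<close> distinct variables (the formal arguments) and a formula \<open>C\<close>, possibly with
  further free variables; an atom \<open>P(z\<^sub>1,\<dots>,z\<^sub>n)\<close> is replaced by \<open>C[z\<^sub>1,\<dots>,z\<^sub>n/x\<^sub>1,\<dots>,x\<^sub>n]\<close>. A letter
  is left unchanged if \<open>C\<close> is \<open>P(x\<^sub>1,\<dots>,x\<^sub>n)\<close>.\<close>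

type_synonym psubstitution = "nat \<Rightarrow> nat \<Rightarrow> var list \<times> fm"

definition wf_psubstitution :: "psubstitution \<Rightarrow> bool" where
  "wf_psubstitution S \<longleftrightarrow> (\<forall>P n. length (fst (S P n)) = n \<and> distinct (fst (S P n)))"

primrec psub :: "psubstitution \<Rightarrow> fm \<Rightarrow> fm" where
  "psub S (Pr P zs) = (let (xs, C) = S P (length zs) in vsub (params xs zs) C)"
| "psub S FBot = FBot"
| "psub S (A \<rightarrow>\<^sub>F B) = psub S A \<rightarrow>\<^sub>F psub S B"
| "psub S (FDia A) = FDia (psub S A)"
| "psub S (FEx x A) = FEx x (psub S A)"

text \<open>\<open>padm {} S A\<close>: no variable is captured when \<open>S\<close> is applied to \<open>A\<close>, neither an actual argument
  by a quantifier of a substituted formula, nor a further free variable of a substituted formula by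
  a quantifier of \<open>A\<close>. The set \<open>Y\<close> collects the variables bound at the current position in \<open>A\<close>.\<close>

primrec padm :: "var set \<Rightarrow> psubstitution \<Rightarrow> fm \<Rightarrow> bool" where
  "padm Y S (Pr P zs) \<longleftrightarrow>
     (let (xs, C) = S P (length zs)
      in free_for (params xs zs) C \<and> (fv C - set xs) \<inter> Y = {})"
| "padm Y S FBot \<longleftrightarrow> True"
| "padm Y S (A \<rightarrow>\<^sub>F B) \<longleftrightarrow> padm Y S A \<and> padm Y S B"
| "padm Y S (FDia A) \<longleftrightarrow> padm Y S A"
| "padm Y S (FEx x A) \<longleftrightarrow> padm (insert x Y) S A"

primrec in_pred :: "ufm \<Rightarrow> fm" where
  "in_pred (UVar i) = Pr i []"
| "in_pred UBot = FBot"
| "in_pred (\<phi> \<rightarrow>\<^sub>U \<psi>) = in_pred \<phi> \<rightarrow>\<^sub>F in_pred \<psi>"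
| "in_pred (UDia \<phi>) = FDia (in_pred \<phi>)"

text \<open>Classical predicate logic enters through the tautologies and the four quantifier axiom schemes
  of the usual Hilbert calculus with Modus Ponens and generalization. Both pairs of schemes are
  listed because \<open>\<forall>\<close> abbreviates \<open>\<not>\<exists>\<not>\<close>.\<close>

definition predicate_modal_logic :: "fm set \<Rightarrow> bool" where
  "predicate_modal_logic Q \<longleftrightarrow>
     (\<forall>A. ftautology A \<longrightarrow> A \<in> Q) \<and>
     (\<forall>x y A. free_for (id(x := y)) A \<longrightarrow> FAll x A \<rightarrow>\<^sub>F vsub (id(x := y)) A \<in> Q) \<and>
     (\<forall>x y A. free_for (id(x := y)) A \<longrightarrow> vsub (id(x := y)) A \<rightarrow>\<^sub>F FEx x A \<in> Q) \<and>
     (\<forall>x A B. x \<notin> fv B \<longrightarrow> FAll x (B \<rightarrow>\<^sub>F A) \<rightarrow>\<^sub>F (B \<rightarrow>\<^sub>F FAll x A) \<in> Q) \<and>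
     (\<forall>x A B. x \<notin> fv B \<longrightarrow> FAll x (A \<rightarrow>\<^sub>F B) \<rightarrow>\<^sub>F (FEx x A \<rightarrow>\<^sub>F B) \<in> Q) \<and>
     in_pred ax_K \<in> Q \<and> in_pred ax_Dual \<in> Q \<and>
     (\<forall>A B. A \<rightarrow>\<^sub>F B \<in> Q \<longrightarrow> A \<in> Q \<longrightarrow> B \<in> Q) \<and>
     (\<forall>x A. A \<in> Q \<longrightarrow> FAll x A \<in> Q) \<and>
     (\<forall>A. A \<in> Q \<longrightarrow> FBox A \<in> Q) \<and>
     (\<forall>S A. wf_psubstitution S \<longrightarrow> padm {} S A \<longrightarrow> A \<in> Q \<longrightarrow> psub S A \<in> Q)"

definition qplus :: "fm set \<Rightarrow> fm set \<Rightarrow> fm set" where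
  "qplus Q \<Gamma> = \<Inter> {R. predicate_modal_logic R \<and> Q \<subseteq> R \<and> \<Gamma> \<subseteq> R}"

definition barcan :: fm where
  "barcan = FDia (FEx 0 (Pr 0 [0])) \<rightarrow>\<^sub>F FEx 0 (FDia (Pr 0 [0]))"

definition QLB :: "ufm set \<Rightarrow> fm set" where
  "QLB L = \<Inter> {Q. predicate_modal_logic Q \<and> in_pred ` L \<subseteq> Q \<and> barcan \<in> Q}"

definition QGLB :: "fm set" where
  "QGLB = QLB GL"

definition QGrzB :: "fm set" where
  "QGrzB = QLB Grz"

text \<open>First-order formulae without modalities, with all intuitionistic connectives primitive.\<close>

datatype ifm =
    IPr nat "var list"
  | IBot
  | IAnd ifm ifm
  | IOr ifm ifm
  | IImp ifm ifm  (infixr \<open>\<rightarrow>\<^sub>I\<close> 55)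
  | IAll var ifm
  | IEx var ifm

primrec goedel :: "ifm \<Rightarrow> fm" where
  "goedel (IPr P zs) = FBox (Pr P zs)"
| "goedel IBot = FBot"
| "goedel (IAnd A B) = goedel A \<and>\<^sub>F goedel B"
| "goedel (IOr A B) = goedel A \<or>\<^sub>F goedel B"
| "goedel (A \<rightarrow>\<^sub>I B) = FBox (goedel A \<rightarrow>\<^sub>F goedel B)"
| "goedel (IAll x A) = FBox (FAll x (goedel A))"
| "goedel (IEx x A) = FEx x (goedel A)"

definition casari :: ifm where
  "casari =
     (let P = IPr 0 [0]
      in IAll 0 ((P \<rightarrow>\<^sub>I IAll 0 P) \<rightarrow>\<^sub>I IAll 0 P) \<rightarrow>\<^sub>I IAll 0 P)"

definition QpGrzB :: "fm set" where
  "QpGrzB = qplus QGrzB {goedel casari}"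

definition qdepth :: "fm set \<Rightarrow> nat \<Rightarrow> fm set" where
  "qdepth Q n = qplus Q {in_pred (bd n)}"


section \<open>One-variable fragments\<close>

primrec one_var :: "var \<Rightarrow> (nat \<Rightarrow> nat) \<Rightarrow> bfm \<Rightarrow> fm" where
  "one_var x l (BVar i) = Pr (l i) [x]"
| "one_var x l BBot = FBot"
| "one_var x l (\<phi> \<rightarrow>\<^sub>B \<psi>) = one_var x l \<phi> \<rightarrow>\<^sub>F one_var x l \<psi>"
| "one_var x l (BDia \<phi>) = FDia (one_var x l \<phi>)"
| "one_var x l (BEx \<phi>) = FEx x (one_var x l \<phi>)"

definition axiomatizes_one_var_fragment ::
    "var \<Rightarrow> (nat \<Rightarrow> nat) \<Rightarrow> bfm set \<Rightarrow> fm set \<Rightarrow> bool" where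
  "axiomatizes_one_var_fragment x l M Q \<longleftrightarrow> (\<forall>\<phi>. \<phi> \<in> M \<longleftrightarrow> one_var x l \<phi> \<in> Q)"

end

theory Submission
  imports Defs "HOL-Library.Countable_Set"
begin

text \<open>Soundness is a derivation of the translated axioms; the axioms about the variable \<open>0\<close> are moved
  to \<open>x\<close> by renaming bound variables.

  For completeness, let \<open>\<phi>\<close> be a non-theorem and restrict the points of the canonical model, where
  \<open>R\<close> and \<open>E\<close> commute, to types, that is, to their subformulas of \<open>\<phi>\<close>. An \<open>E\<close>-class becomes a finite
  set of types. Call such a set repairable in \<open>G\<close> if each \<open>\<diamond>\<psi>\<close> in one of its types \<open>t\<close> is witnessed by a
  member of \<open>G\<close>, along a relation that is total and surjective between the two sets (this is where
  the Barcan formula and its converse enter). Starting from the empty collection, finitely many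
  rounds of adding all repairable sets exhaust the canonical model: by the Loeb axiom, or by Grz
  together with Casari's axiom, a class that is never reached could be left for good over and over
  again, although only finitely many defects exist. If \<open>bd\<^sub>n\<close> is present, \<open>n\<close> rounds suffice.

  The resulting well-founded family is turned into a predicate Kripke model with constant domain
  \<open>nat\<close>: its worlds are pairs of a rank and a function from \<open>nat\<close> onto a set of types of that
  rank, taking each value infinitely often, ordered by decreasing rank and pointwise
  compatibility.\<close>

section \<open>Derivations in predicate modal logics\<close>

lemma id_upd [simp]: "id(x := x) = id" "(\<lambda>a. a)(x := x) = (\<lambda>a. a)"
  by auto

lemma vsub_id [simp]: "vsub id A = A"
  by (induction A) simp_all

lemma free_for_id [simp]: "free_for id A"
  by (induction A) auto

lemma params_Nil [simp]: "params [] [] = id"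
  by (auto simp: params_def)

lemma params_self [simp]: "params [x] [x] = id"
  by (auto simp: params_def)

lemma fv_one_var: "fv (one_var x l \<phi>) \<subseteq> {x}"
  by (induction \<phi>) auto

locale pml =
  fixes Q :: "fm set"
  assumes pml: "predicate_modal_logic Q"
begin

lemmas pml_conjuncts = pml[unfolded predicate_modal_logic_def]

lemmas taut = pml_conjuncts[THEN conjunct1, rule_format]
  and all_inst = pml_conjuncts[THEN conjunct2, THEN conjunct1, rule_format]
  and ex_inst = pml_conjuncts[THEN conjunct2, THEN conjunct2, THEN conjunct1, rule_format]
  and all_distrib = pml_conjuncts[THEN conjunct2, THEN conjunct2, THEN conjunct2, THEN conjunct1, rule_format]
  and ex_distrib = pml_conjuncts[THEN conjunct2, THEN conjunct2, THEN conjunct2, THEN conjunct2, THEN conjunct1, rule_format]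
  and K = pml_conjuncts[THEN conjunct2, THEN conjunct2, THEN conjunct2, THEN conjunct2, THEN conjunct2, THEN conjunct1, rule_format]
  and Dual = pml_conjuncts[THEN conjunct2, THEN conjunct2, THEN conjunct2, THEN conjunct2, THEN conjunct2, THEN conjunct2, THEN conjunct1, rule_format]
  and mp = pml_conjuncts[THEN conjunct2, THEN conjunct2, THEN conjunct2, THEN conjunct2, THEN conjunct2, THEN conjunct2, THEN conjunct2, THEN conjunct1, rule_format]
  and gen = pml_conjuncts[THEN conjunct2, THEN conjunct2, THEN conjunct2, THEN conjunct2, THEN conjunct2, THEN conjunct2, THEN conjunct2, THEN conjunct2, THEN conjunct1, rule_format]
  and nec = pml_conjuncts[THEN conjunct2, THEN conjunct2, THEN conjunct2, THEN conjunct2, THEN conjunct2, THEN conjunct2, THEN conjunct2, THEN conjunct2, THEN conjunct2, THEN conjunct1, rule_format]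
  and subst = pml_conjuncts[THEN conjunct2, THEN conjunct2, THEN conjunct2, THEN conjunct2, THEN conjunct2, THEN conjunct2, THEN conjunct2, THEN conjunct2, THEN conjunct2, THEN conjunct2, rule_format]

lemma mp2: "ftautology (A \<rightarrow>\<^sub>F B \<rightarrow>\<^sub>F C) \<Longrightarrow> A \<in> Q \<Longrightarrow> B \<in> Q \<Longrightarrow> C \<in> Q"
  using taut mp by blast

lemma trans_imp: "A \<rightarrow>\<^sub>F B \<in> Q \<Longrightarrow> B \<rightarrow>\<^sub>F C \<in> Q \<Longrightarrow> A \<rightarrow>\<^sub>F C \<in> Q"
  by (rule mp2[of "A \<rightarrow>\<^sub>F B" "B \<rightarrow>\<^sub>F C"]) (auto simp: ftautology_def)

lemma ex_I: "A \<rightarrow>\<^sub>F FEx x A \<in> Q"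
  using ex_inst[of x x A] by simp

lemma all_E: "FAll x A \<rightarrow>\<^sub>F A \<in> Q"
  using all_inst[of x x A] by simp

lemma ex_E: "A \<rightarrow>\<^sub>F B \<in> Q \<Longrightarrow> x \<notin> fv B \<Longrightarrow> FEx x A \<rightarrow>\<^sub>F B \<in> Q"
  using ex_distrib gen mp by blast

lemma all_I: "B \<rightarrow>\<^sub>F A \<in> Q \<Longrightarrow> x \<notin> fv B \<Longrightarrow> B \<rightarrow>\<^sub>F FAll x A \<in> Q"
  using all_distrib gen mp by blast

lemma ex_mono: "A \<rightarrow>\<^sub>F B \<in> Q \<Longrightarrow> FEx x A \<rightarrow>\<^sub>F FEx x B \<in> Q"
  by (rule ex_E) (auto intro: trans_imp ex_I)

text \<open>\<open>in_pred\<close> yields quantifier-free formulas over letters of arity 0, so any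
  formula may be put in for these letters without capture. The clause for other arities only makes
  the substitution well-formed. K and duality, stated for particular letters, thereby become
  schemes.\<close>

lemma in_pred_subst:
  assumes "in_pred \<phi> \<in> Q"
  shows "psub (\<lambda>P n. if n = 0 then ([], F P) else ([0..<n], FBot)) (in_pred \<phi>) \<in> Q" (is "psub ?S _ \<in> _")
proof (rule subst[OF _ _ assms])
  show "wf_psubstitution ?S" by (simp add: wf_psubstitution_def)
  show "padm {} ?S (in_pred \<phi>)" by (induction \<phi>) auto
qed

lemma dia_mono:
  assumes "A \<rightarrow>\<^sub>F B \<in> Q"
  shows "FDia A \<rightarrow>\<^sub>F FDia B \<in> Q"
proof -
  have "FNot B \<rightarrow>\<^sub>F FNot A \<in> Q"
    by (rule mp[OF taut assms]) (auto simp: ftautology_def)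
  then have "FBox (FNot B \<rightarrow>\<^sub>F FNot A) \<in> Q" by (rule nec)
  moreover have "FBox (FNot B \<rightarrow>\<^sub>F FNot A) \<rightarrow>\<^sub>F (FBox (FNot B) \<rightarrow>\<^sub>F FBox (FNot A)) \<in> Q"
    using in_pred_subst[OF K, of "\<lambda>P. if P = 0 then FNot B else FNot A"] by (simp add: ax_K_def)
  ultimately have 1: "FBox (FNot B) \<rightarrow>\<^sub>F FBox (FNot A) \<in> Q" using mp by blast
  have 2: "(FDia C \<rightarrow>\<^sub>F FNot (FBox (FNot C))) \<and>\<^sub>F (FNot (FBox (FNot C)) \<rightarrow>\<^sub>F FDia C) \<in> Q" for C
    using in_pred_subst[OF Dual, of "\<lambda>P. C"] by (simp add: ax_Dual_def)
  have "FDia A \<rightarrow>\<^sub>F FNot (FBox (FNot A)) \<in> Q"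
    by (rule mp[OF taut 2[of A]]) (auto simp: ftautology_def)
  moreover have "FNot (FBox (FNot A)) \<rightarrow>\<^sub>F FNot (FBox (FNot B)) \<in> Q"
    by (rule mp[OF taut 1]) (auto simp: ftautology_def)
  moreover have "FNot (FBox (FNot B)) \<rightarrow>\<^sub>F FDia B \<in> Q"
    by (rule mp[OF taut 2[of B]]) (auto simp: ftautology_def)
  ultimately show ?thesis using trans_imp by blast
qed

lemma one_var_in_dia:
  assumes "in_pred \<phi> \<in> Q"
  shows "one_var x l (in_dia \<phi>) \<in> Q"
proof -
  from assms
  have "psub (\<lambda>P n. if n = 0 then ([], Pr (l P) [x]) else ([0..<n], FBot)) (in_pred \<phi>) \<in> Q"
    by (rule in_pred_subst)
  moreover have "psub (\<lambda>P n. if n = 0 then ([], Pr (l P) [x]) else ([0..<n], FBot)) (in_pred \<phi>)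
      = one_var x l (in_dia \<phi>)" for \<phi>
    by (induction \<phi>) auto
  ultimately show ?thesis by simp
qed

text \<open>The formula replacing a unary letter has at most \<open>x\<close> free, and
  \<open>x\<close> is its formal argument, so quantifiers over \<open>x\<close> capture nothing.
  Injectivity lets \<open>inv l\<close> recover the propositional letter. Allowing another
  \<open>l'\<close> makes it possible to change the assignment of letters.\<close>

lemma one_var_bsubst:
  assumes "inj l" and "one_var x l \<phi> \<in> Q"
  shows "one_var x l' (bsubst s \<phi>) \<in> Q"
proof -
  define S where "S = (\<lambda>P n. if n = Suc 0 then ([x], one_var x l' (s (inv l P))) else ([0..<n], FBot))"
  have "(fv (one_var x l' \<psi>) - {x}) \<inter> Y = {}" for \<psi> Y
    using fv_one_var by blast
  then have "padm Y S (one_var x l \<phi>)" for Y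
    using assms(1) by (induction \<phi> arbitrary: Y) (simp_all add: S_def del: Int_Diff Diff_eq_empty_iff)
  moreover have "wf_psubstitution S"
    by (simp add: wf_psubstitution_def S_def)
  ultimately have "psub S (one_var x l \<phi>) \<in> Q"
    using assms(2) subst by blast
  moreover have "psub S (one_var x l \<phi>) = one_var x l' (bsubst s \<phi>)"
    using assms(1) by (induction \<phi>) (simp_all add: S_def)
  ultimately show ?thesis by simp
qed

lemma imp_cong:
  assumes "A \<rightarrow>\<^sub>F A' \<in> Q" "A' \<rightarrow>\<^sub>F A \<in> Q" "B \<rightarrow>\<^sub>F B' \<in> Q" "B' \<rightarrow>\<^sub>F B \<in> Q"
  shows "(A \<rightarrow>\<^sub>F B) \<rightarrow>\<^sub>F (A' \<rightarrow>\<^sub>F B') \<in> Q"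
  by (rule mp2[OF _ assms(2,3)]) (auto simp: ftautology_def)

text \<open>Replacing the free \<open>z\<close> by \<open>y\<close> leaves bound occurrences of
  \<open>z\<close> alone, while \<open>one_var y\<close> binds \<open>y\<close> everywhere, so the
  two formulas agree only up to provable equivalence. Freedom for the substitution is proved along
  with it because the quantifier case uses \<open>ex_inst\<close>.\<close>

lemma one_var_rename_free:
  "one_var y l \<phi> \<rightarrow>\<^sub>F vsub (id(z := y)) (one_var z l \<phi>) \<in> Q \<and>
   vsub (id(z := y)) (one_var z l \<phi>) \<rightarrow>\<^sub>F one_var y l \<phi> \<in> Q \<and>
   free_for (id(z := y)) (one_var z l \<phi>)"
proof (induction \<phi> arbitrary: y z)
  case (BVar i)
  then show ?case by (auto intro!: taut simp: ftautology_def)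
next
  case BBot
  then show ?case by (auto intro!: taut simp: ftautology_def)
next
  case (BImp \<phi> \<psi>)
  then show ?case by (auto intro!: imp_cong)
next
  case (BDia \<phi>)
  then show ?case by (auto intro!: dia_mono)
next
  case (BEx \<phi>)
  have *: "FEx y (one_var y l \<phi>) \<rightarrow>\<^sub>F FEx z (one_var z l \<phi>) \<in> Q" for y z
  proof (cases "y = z")
    case True
    then show ?thesis by (auto intro!: taut simp: ftautology_def)
  next
    case False
    with fv_one_var[of z l \<phi>] have "y \<notin> fv (FEx z (one_var z l \<phi>))" by auto
    moreover have "one_var y l \<phi> \<rightarrow>\<^sub>F FEx z (one_var z l \<phi>) \<in> Q"
      using trans_imp BEx ex_inst by blast
    ultimately show ?thesis by (rule ex_E[rotated])
  qed
  have "(id(z := y))(z := z) = id" by auto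
  moreover have "\<forall>v \<in> fv (one_var z l \<phi>) - {z}. (id(z := y)) v \<noteq> z"
    using fv_one_var by fastforce
  ultimately show ?case
    using * by (simp only: one_var.simps vsub.simps free_for.simps vsub_id free_for_id simp_thms)
qed

lemma one_var_rename: "one_var z l \<phi> \<in> Q \<Longrightarrow> one_var y l \<phi> \<in> Q"
  using one_var_rename_free[of y l \<phi> z] all_inst gen mp by blast

lemma one_var_instance:
  "one_var 0 id \<phi> \<in> Q \<Longrightarrow> one_var x l (bsubst s \<phi>) \<in> Q"
  by (rule one_var_bsubst[of id]) (auto intro: one_var_rename)

end

lemma predicate_modal_logic_Inter:
  assumes "\<And>Q. Q \<in> C \<Longrightarrow> predicate_modal_logic Q"
  shows "predicate_modal_logic (\<Inter> C)"
proof -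
  have *: "pml Q" if "Q \<in> C" for Q
    using assms that by (simp add: pml_def)
  show ?thesis
    unfolding predicate_modal_logic_def
  proof (intro conjI allI impI InterI)
    fix A B Q assume "A \<rightarrow>\<^sub>F B \<in> \<Inter> C" "A \<in> \<Inter> C" "Q \<in> C"
    then show "B \<in> Q" using pml.mp[OF *, of Q A B] by simp
  qed (simp_all add: pml.taut pml.all_inst pml.ex_inst pml.all_distrib pml.ex_distrib pml.K pml.Dual
        pml.gen pml.nec pml.subst *)
qed

lemma in_ex_usubst: "in_ex (usubst s \<phi>) = bsubst (in_ex \<circ> s) (in_ex \<phi>)"
  by (induction \<phi>) auto

text \<open>S5 is the least normal logic with its axioms, so it suffices that the formulas
  translated into \<open>Q\<close>, with the modality read as a quantifier over \<open>x\<close>,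
  form a normal logic with these axioms.\<close>

lemma (in pml) one_var_in_ex_S5:
  assumes "inj l"
  shows "one_var x l ` in_ex ` S5 \<subseteq> Q"
proof -
  define N where "N = {\<phi>. one_var x l (in_ex \<phi>) \<in> Q}"
  \<comment> \<open>A \<open>UDia\<close> formula becomes an \<open>FEx\<close> formula, and both
    count as atoms for the respective truth tables.\<close>
  have tr: "ftruth v (one_var x l (in_ex \<phi>)) = utruth (\<lambda>\<psi>. ftruth v (one_var x l (in_ex \<psi>))) \<phi>" for v \<phi>
    by (induction \<phi>) auto
  let ?P = "Pr (l 0) [x]" and ?R = "Pr (l 1) [x]"
  have "normal_logic N"
    unfolding normal_logic_def
  proof (intro conjI allI impI)
    fix \<phi> assume "utautology \<phi>"
    then have "ftautology (one_var x l (in_ex \<phi>))"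
      unfolding utautology_def ftautology_def by (subst tr) blast
    then show "\<phi> \<in> N" by (simp add: N_def taut)
  next
    have "FAll x (?P \<rightarrow>\<^sub>F ?R) \<and>\<^sub>F FAll x ?P \<rightarrow>\<^sub>F ?R \<in> Q"
      by (rule mp2[OF _ all_E[of x "?P \<rightarrow>\<^sub>F ?R"] all_E[of x ?P]]) (auto simp: ftautology_def)
    then have "FAll x (?P \<rightarrow>\<^sub>F ?R) \<and>\<^sub>F FAll x ?P \<rightarrow>\<^sub>F FAll x ?R \<in> Q"
      by (rule all_I) simp
    then have "FAll x (?P \<rightarrow>\<^sub>F ?R) \<rightarrow>\<^sub>F (FAll x ?P \<rightarrow>\<^sub>F FAll x ?R) \<in> Q"
      by (rule mp[OF taut, rotated]) (auto simp: ftautology_def)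
    then show "ax_K \<in> N" by (simp add: N_def ax_K_def)
  next
    have "FEx x ?P \<rightarrow>\<^sub>F FEx x (FNot (FNot ?P)) \<in> Q" "FEx x (FNot (FNot ?P)) \<rightarrow>\<^sub>F FEx x ?P \<in> Q"
      by (rule ex_mono, rule taut, simp add: ftautology_def)+
    then have "one_var x l (in_ex ax_Dual) \<in> Q"
      by (rule mp2[rotated]) (auto simp: ftautology_def ax_Dual_def)
    then show "ax_Dual \<in> N" by (simp add: N_def)
  next
    fix \<phi> \<psi> assume "\<phi> \<rightarrow>\<^sub>U \<psi> \<in> N" "\<phi> \<in> N"
    then show "\<psi> \<in> N" using mp[of "one_var x l (in_ex \<phi>)"] by (simp add: N_def)
  next
    fix \<phi> s assume "\<phi> \<in> N"
    then show "usubst s \<phi> \<in> N" by (simp add: N_def in_ex_usubst one_var_bsubst[OF assms])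
  next
    fix \<phi> assume "\<phi> \<in> N"
    then show "UBox \<phi> \<in> N" by (simp add: N_def gen)
  qed
  moreover have "FAll x ?P \<rightarrow>\<^sub>F FAll x (FAll x ?P) \<in> Q"
    by (rule all_I) (auto intro!: taut simp: ftautology_def)
  moreover have "FEx x ?P \<rightarrow>\<^sub>F FAll x (FEx x ?P) \<in> Q"
    by (rule all_I) (auto intro!: taut simp: ftautology_def)
  ultimately have "S5 \<subseteq> N"
    unfolding S5_def K_plus_def by (intro Inter_lower) (simp add: N_def all_E[simplified])
  then show ?thesis by (auto simp: N_def)
qed

section \<open>Soundness of the fusion with S5 and of the commutation axioms\<close>

context pml
begin

lemma one_var_bclosed:
  assumes "inj l"
  shows "bclosed {\<phi>. one_var x l \<phi> \<in> Q}"
  unfolding bclosed_def mem_Collect_eq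
proof (intro conjI allI impI)
  fix \<phi> \<psi> assume "one_var x l (\<phi> \<rightarrow>\<^sub>B \<psi>) \<in> Q" "one_var x l \<phi> \<in> Q"
  then show "one_var x l \<psi> \<in> Q" using mp[of "one_var x l \<phi>"] by simp
qed (simp_all add: nec gen one_var_bsubst[OF assms])

text \<open>Holds in every predicate modal logic: the diamond is monotone, \<open>ex_I\<close> can
  be taken under it, and \<open>x\<close> is not free in the result.\<close>

lemma one_var_converse_barcan:
  "one_var x l (BEx (BDia (BVar 0)) \<rightarrow>\<^sub>B BDia (BEx (BVar 0))) \<in> Q"
  using ex_E[OF dia_mono[OF ex_I]] by simp

lemma one_var_barcan:
  assumes "barcan \<in> Q"
  shows "one_var x l (BDia (BEx (BVar 0)) \<rightarrow>\<^sub>B BEx (BDia (BVar 0))) \<in> Q"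
  using one_var_instance[of "BDia (BEx (BVar 0)) \<rightarrow>\<^sub>B BEx (BDia (BVar 0))" x l BVar] assms
  by (simp add: barcan_def)

lemma one_var_MLB:
  assumes "inj l" and "in_pred ` L \<subseteq> Q" and "barcan \<in> Q"
  shows "MLB L \<subseteq> {\<phi>. one_var x l \<phi> \<in> Q}"
proof -
  let ?M = "{\<phi>. one_var x l \<phi> \<in> Q}"
  have closed: "bclosed ?M" using one_var_bclosed[OF assms(1)] .
  have "in_dia ` L \<subseteq> ?M" "in_ex ` S5 \<subseteq> ?M"
    using assms(2) one_var_in_dia one_var_in_ex_S5[OF assms(1), of x] by auto
  with closed have "fusion_S5 L \<subseteq> ?M"
    unfolding fusion_S5_def by (intro Inter_lower) simp
  moreover have "{BEx (BDia (BVar 0)) \<rightarrow>\<^sub>B BDia (BEx (BVar 0)),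
      BDia (BEx (BVar 0)) \<rightarrow>\<^sub>B BEx (BDia (BVar 0))} \<subseteq> ?M"
    unfolding insert_subset mem_Collect_eq
    using one_var_converse_barcan one_var_barcan[OF assms(3)] by simp
  ultimately show ?thesis
    using closed unfolding MLB_def bplus_def by (intro Inter_lower) simp
qed

end

section \<open>Kripke semantics with constant domains\<close>

primrec usem :: "('w \<Rightarrow> 'w \<Rightarrow> bool) \<Rightarrow> (nat \<Rightarrow> 'w \<Rightarrow> bool) \<Rightarrow> 'w \<Rightarrow> ufm \<Rightarrow> bool" where
  "usem R V w (UVar i) = V i w"
| "usem R V w UBot = False"
| "usem R V w (\<phi> \<rightarrow>\<^sub>U \<psi>) = (usem R V w \<phi> \<longrightarrow> usem R V w \<psi>)"
| "usem R V w (UDia \<phi>) = (\<exists>v. R w v \<and> usem R V v \<phi>)"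

text \<open>Individuals are natural numbers at every world. This makes the domains constant and the
  Barcan formula valid.\<close>

primrec sem :: "('w \<Rightarrow> 'w \<Rightarrow> bool) \<Rightarrow> (nat \<Rightarrow> 'w \<Rightarrow> nat list \<Rightarrow> bool) \<Rightarrow> 'w \<Rightarrow> (var \<Rightarrow> nat) \<Rightarrow> fm \<Rightarrow> bool"
where
  "sem R V w g (Pr P zs) = V P w (map g zs)"
| "sem R V w g FBot = False"
| "sem R V w g (A \<rightarrow>\<^sub>F B) = (sem R V w g A \<longrightarrow> sem R V w g B)"
| "sem R V w g (FDia A) = (\<exists>v. R w v \<and> sem R V v g A)"
| "sem R V w g (FEx x A) = (\<exists>d. sem R V w (g(x := d)) A)"

lemma usem_usubst: "usem R V w (usubst s \<phi>) = usem R (\<lambda>i w. usem R V w (s i)) w \<phi>"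
  by (induction \<phi> arbitrary: w) auto

lemma usem_utruth: "usem R V w \<phi> = utruth (usem R V w) \<phi>"
  by (induction \<phi>) auto

lemma sem_ftruth: "sem R V w g A = ftruth (sem R V w g) A"
  by (induction A) auto

lemma sem_in_pred: "sem R V w g (in_pred \<phi>) = usem R (\<lambda>i w. V i w []) w \<phi>"
  by (induction \<phi> arbitrary: w) auto

lemma sem_cong: "\<forall>v \<in> fv A. g v = h v \<Longrightarrow> sem R V w g A = sem R V w h A"
proof (induction A arbitrary: w g h)
  case (Pr P zs)
  then have "map g zs = map h zs" by simp
  then show ?case by (simp only: sem.simps)
next
  case (FImp A B)
  then show ?case by simp blast
next
  case (FDia A)
  have "sem R V v g A = sem R V v h A" for v
    by (rule FDia.IH) (use FDia.prems in auto)
  then show ?case by simp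
next
  case (FEx x A)
  have "sem R V w (g(x := d)) A = sem R V w (h(x := d)) A" for d
    by (rule FEx.IH) (use FEx.prems in auto)
  then show ?case by simp
qed simp

lemma sem_vsub: "free_for s A \<Longrightarrow> sem R V w g (vsub s A) = sem R V w (g \<circ> s) A"
proof (induction A arbitrary: w g s)
  case (FEx x A)
  have "sem R V w (g(x := d)) (vsub (s(x := x)) A) = sem R V w ((g \<circ> s)(x := d)) A" for d
    using FEx by (subst FEx.IH) (auto intro!: sem_cong)
  then show ?case by (simp only: sem.simps vsub.simps)
qed simp_all

lemma params_notin: "v \<notin> set xs \<Longrightarrow> params xs zs v = v"
  by (auto simp: params_def split: option.split dest!: map_of_SomeD dest: set_zip_leftD)

definition args :: "(var \<Rightarrow> nat) \<Rightarrow> var list \<Rightarrow> nat list \<Rightarrow> var \<Rightarrow> nat" where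
  "args g xs ds v = (case map_of (zip xs ds) v of None \<Rightarrow> g v | Some d \<Rightarrow> d)"

lemma args_notin: "v \<notin> set xs \<Longrightarrow> args g xs ds v = g v"
  by (auto simp: args_def split: option.split dest!: map_of_SomeD dest: set_zip_leftD)

lemma args_params:
  assumes "length xs = length zs" and "v \<in> set xs"
  shows "args h xs (map g zs) v = g (params xs zs v)"
  using assms by (induction xs zs rule: list_induct2) (auto simp: args_def params_def)

text \<open>The further free variables of the substituted formulas are evaluated by the fixed assignment \<open>h\<close>.\<close>

definition psub_val ::
    "('w \<Rightarrow> 'w \<Rightarrow> bool) \<Rightarrow> (nat \<Rightarrow> 'w \<Rightarrow> nat list \<Rightarrow> bool) \<Rightarrow> (var \<Rightarrow> nat) \<Rightarrow> psubstitution
      \<Rightarrow> nat \<Rightarrow> 'w \<Rightarrow> nat list \<Rightarrow> bool" where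
  "psub_val R V h S P w ds = (let (xs, C) = S P (length ds) in sem R V w (args h xs ds) C)"

text \<open>Below quantifiers of \<open>A\<close> the assignment \<open>g\<close> departs from
  \<open>h\<close> only on variables in \<open>Y\<close>. Admissibility keeps the further free
  variables of the substituted formulas out of \<open>Y\<close>, so \<open>h\<close> evaluates them
  correctly.\<close>

lemma sem_psub:
  assumes "wf_psubstitution S" and "padm Y S A" and "\<forall>v. v \<notin> Y \<longrightarrow> g v = h v"
  shows "sem R V w g (psub S A) = sem R (psub_val R V h S) w g A"
  using assms(2,3)
proof (induction A arbitrary: w g Y)
  case (Pr P zs)
  obtain xs C where S: "S P (length zs) = (xs, C)" by (cases "S P (length zs)")
  with assms(1) have len: "length xs = length zs"
    unfolding wf_psubstitution_def by (metis fst_conv)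
  have "sem R V w g (vsub (params xs zs) C) = sem R V w (g \<circ> params xs zs) C"
    using Pr S by (simp add: sem_vsub)
  also have "\<dots> = sem R V w (args h xs (map g zs)) C"
  proof (rule sem_cong, rule ballI)
    fix v assume v: "v \<in> fv C"
    show "(g \<circ> params xs zs) v = args h xs (map g zs) v"
    proof (cases "v \<in> set xs")
      case True
      then show ?thesis using args_params[OF len, of v h g] by simp
    next
      case False
      then have "v \<notin> Y" using v Pr S by auto
      then show ?thesis using False Pr.prems(2) by (simp add: params_notin args_notin)
    qed
  qed
  finally show ?case by (simp add: S psub_val_def)
next
  case (FEx x A)
  have "sem R V w (g(x := d)) (psub S A) = sem R (psub_val R V h S) w (g(x := d)) A" for d
    by (rule FEx.IH[of "insert x Y"]) (use FEx.prems in auto)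
  then show ?case by simp
qed auto

section \<open>Validity on frames\<close>

definition uvalid :: "'w set \<Rightarrow> ('w \<Rightarrow> 'w \<Rightarrow> bool) \<Rightarrow> ufm set" where
  "uvalid W R = {\<phi>. \<forall>V. \<forall>w\<in>W. usem R V w \<phi>}"

text \<open>\<open>W\<close> restricts the points of evaluation, whereas the diamond ranges over all
  \<open>R\<close>-successors; this is why the soundness lemmas assume \<open>W\<close> closed under
  \<open>R\<close>.\<close>

definition valid :: "'w set \<Rightarrow> ('w \<Rightarrow> 'w \<Rightarrow> bool) \<Rightarrow> fm set" where
  "valid W R = {A. \<forall>V. \<forall>w\<in>W. \<forall>g. sem R V w g A}"

lemma normal_logic_uvalid:
  assumes "\<And>w v. R w v \<Longrightarrow> w \<in> W \<Longrightarrow> v \<in> W"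
  shows "normal_logic (uvalid W R)"
  unfolding normal_logic_def
proof (intro conjI allI impI)
  fix \<phi> assume "utautology \<phi>"
  then have "usem R V w \<phi>" for V w
    by (subst usem_utruth) (simp add: utautology_def)
  then show "\<phi> \<in> uvalid W R" by (simp add: uvalid_def)
qed (use assms in \<open>auto simp: uvalid_def ax_K_def ax_Dual_def usem_usubst\<close>)

lemma in_pred_valid: "\<phi> \<in> uvalid W R \<Longrightarrow> in_pred \<phi> \<in> valid W R"
  by (simp add: uvalid_def valid_def sem_in_pred)

lemma predicate_modal_logic_valid:
  assumes R: "\<And>w v. R w v \<Longrightarrow> w \<in> W \<Longrightarrow> v \<in> W"
  shows "predicate_modal_logic (valid W R)"
  unfolding predicate_modal_logic_def
proof (intro conjI allI impI)
  fix A assume "ftautology A"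
  then have "sem R V w g A" for V w g
    by (subst sem_ftruth) (simp add: ftautology_def)
  then show "A \<in> valid W R" by (simp add: valid_def)
next
  fix x y A assume ff: "free_for (id(x := y)) A"
  have "sem R V w g (vsub (id(x := y)) A) = sem R V w (g(x := g y)) A" for V w g
    using ff by (auto simp: sem_vsub intro!: sem_cong)
  then show "FAll x A \<rightarrow>\<^sub>F vsub (id(x := y)) A \<in> valid W R"
    and "vsub (id(x := y)) A \<rightarrow>\<^sub>F FEx x A \<in> valid W R"
    by (auto simp: valid_def)
next
  fix x A B assume "x \<notin> fv B"
  then have *: "sem R V w (g(x := d)) B = sem R V w g B" for V w g d
    by (auto intro!: sem_cong)
  show "FAll x (B \<rightarrow>\<^sub>F A) \<rightarrow>\<^sub>F (B \<rightarrow>\<^sub>F FAll x A) \<in> valid W R"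
    and "FAll x (A \<rightarrow>\<^sub>F B) \<rightarrow>\<^sub>F (FEx x A \<rightarrow>\<^sub>F B) \<in> valid W R"
    by (auto simp: valid_def *)
next
  fix S A assume "wf_psubstitution S" "padm {} S A" "A \<in> valid W R"
  then show "psub S A \<in> valid W R"
    using sem_psub[of S "{}" A g g R for g] by (simp add: valid_def)
next
  show "in_pred ax_K \<in> valid W R" "in_pred ax_Dual \<in> valid W R"
    using normal_logic_uvalid[of R W] R in_pred_valid unfolding normal_logic_def by blast+
qed (use R in \<open>auto simp: valid_def\<close>)

lemma barcan_valid: "barcan \<in> valid W R"
  by (auto simp: valid_def barcan_def)

lemma QLB_valid:
  assumes "\<And>w v. R w v \<Longrightarrow> w \<in> W \<Longrightarrow> v \<in> W" and "L \<subseteq> uvalid W R"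
  shows "QLB L \<subseteq> valid W R"
  unfolding QLB_def
  using predicate_modal_logic_valid[of R W] assms
  by (intro Inter_lower) (auto intro: barcan_valid in_pred_valid)

lemma K_plus_valid:
  assumes "\<And>w v. R w v \<Longrightarrow> w \<in> W \<Longrightarrow> v \<in> W" and "\<Gamma> \<subseteq> uvalid W R"
  shows "K_plus \<Gamma> \<subseteq> uvalid W R"
  unfolding K_plus_def using normal_logic_uvalid[of R W] assms by (intro Inter_lower) auto

lemma rank_max:
  fixes rk :: "'w \<Rightarrow> nat"
  assumes "P w" and "\<And>w. P w \<Longrightarrow> \<not> Q w \<Longrightarrow> \<exists>v. P v \<and> rk v < rk w"
  shows "\<exists>v. P v \<and> Q v"
  using assms(1) by (induction "rk w" arbitrary: w rule: less_induct) (use assms(2) in blast)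

text \<open>The flag \<open>rx\<close>, here and below, is \<open>False\<close> for \<open>GL\<close> (strict frames) and \<open>True\<close> for \<open>Grz\<close>
  (their reflexive closures).\<close>

definition opt_refl :: "bool \<Rightarrow> ('w \<Rightarrow> 'w \<Rightarrow> bool) \<Rightarrow> 'w \<Rightarrow> 'w \<Rightarrow> bool" where
  "opt_refl rx S w v \<longleftrightarrow> S w v \<or> rx \<and> v = w"

text \<open>A rank in \<open>nat\<close> that drops along \<open>S\<close> bounds every chain from
  \<open>w\<close> by \<open>rk w\<close> steps. This is the form of converse well-foundedness
  behind GL, Grz and Casari, and with explicit bounds behind \<open>bd\<close>.\<close>

locale ranked_frame =
  fixes W :: "'w set" and S :: "'w \<Rightarrow> 'w \<Rightarrow> bool" and rk :: "'w \<Rightarrow> nat"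
  assumes S_W: "S w v \<Longrightarrow> w \<in> W \<Longrightarrow> v \<in> W"
    and S_trans: "S u v \<Longrightarrow> S v w \<Longrightarrow> S u w"
    and S_rk: "S w v \<Longrightarrow> rk v < rk w"
begin

abbreviation R :: "bool \<Rightarrow> 'w \<Rightarrow> 'w \<Rightarrow> bool" where
  "R rx \<equiv> opt_refl rx S"

lemmas R_def = opt_refl_def[of _ S]

lemma R_W: "R rx w v \<Longrightarrow> w \<in> W \<Longrightarrow> v \<in> W"
  using S_W by (auto simp: R_def)

lemma last_point:
  assumes "P w"
  obtains v where "v = w \<or> S w v" "P v" "\<And>u. S v u \<Longrightarrow> \<not> P u"
proof -
  have "\<exists>v. ((v = w \<or> S w v) \<and> P v) \<and> (\<forall>u. S v u \<longrightarrow> \<not> P u)"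
  proof (rule rank_max[where w = w and rk = rk])
    fix v assume v: "(v = w \<or> S w v) \<and> P v" "\<not> (\<forall>u. S v u \<longrightarrow> \<not> P u)"
    then obtain u where "S v u" "P u" by blast
    then show "\<exists>u. ((u = w \<or> S w u) \<and> P u) \<and> rk u < rk v"
      using v(1) S_trans[of w v u] S_rk[of v u] by blast
  qed (simp add: assms)
  then obtain v where "v = w \<or> S w v" "P v" "\<forall>u. S v u \<longrightarrow> \<not> P u" by blast
  then show thesis using that[of v] by simp
qed

lemma GL_valid: "GL \<subseteq> uvalid W (R False)"
proof -
  have "usem (R False) V w (UBox (UBox (UVar 0) \<rightarrow>\<^sub>U UVar 0) \<rightarrow>\<^sub>U UBox (UVar 0))" for V w
  proof -
    { fix u assume u: "S w u" "\<not> V 0 u"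
      obtain v where "v = u \<or> S u v" "\<not> V 0 v" "\<And>t. S v t \<Longrightarrow> V 0 t"
        using last_point[of "\<lambda>v. \<not> V 0 v" u] u by metis
      then have "\<exists>v. S w v \<and> (\<forall>t. S v t \<longrightarrow> V 0 t) \<and> \<not> V 0 v"
        using u S_trans by blast }
    then show ?thesis by (simp add: R_def) blast
  qed
  then show ?thesis
    unfolding GL_def by (intro K_plus_valid[OF R_W]) (auto simp: uvalid_def)
qed

lemma Grz_valid: "Grz \<subseteq> uvalid W (R True)"
proof -
  have "usem (R True) V w (UBox (UBox (UVar 0 \<rightarrow>\<^sub>U UBox (UVar 0)) \<rightarrow>\<^sub>U UVar 0) \<rightarrow>\<^sub>U UVar 0)" for V w
  proof -
    { assume u: "\<not> V 0 w"
      obtain v where "v = w \<or> S w v" "\<not> V 0 v" "\<And>t. S v t \<Longrightarrow> V 0 t"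
        using last_point[of "\<lambda>v. \<not> V 0 v" w] u by metis
      then have "\<exists>v. R True w v \<and> (\<forall>t. R True v t \<longrightarrow> V 0 t \<longrightarrow> (\<forall>s. R True t s \<longrightarrow> V 0 s)) \<and> \<not> V 0 v"
        using S_trans unfolding R_def by blast }
    then show ?thesis by simp blast
  qed
  then show ?thesis
    unfolding Grz_def by (intro K_plus_valid[OF R_W]) (auto simp: uvalid_def)
qed

text \<open>At a last point \<open>v\<close> where the translated conclusion fails, the failure lies
  at \<open>v\<close> itself, so P(d) is false at \<open>v\<close> for some \<open>d\<close>.
  Strictly above \<open>v\<close> the conclusion holds, so the translated implication from P(d) to
  it is true at \<open>v\<close>, and \<open>v\<close> contradicts the premise.\<close>

lemma casari_valid: "goedel casari \<in> valid W (R True)"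
proof -
  have "sem (R True) V w g (goedel casari)" for V w g
  proof -
    \<comment> \<open>\<open>A\<close> is the translation of \<forall>x P(x), and \<open>H\<close>
      is the negation of the translated premise.\<close>
    define A where "A w \<longleftrightarrow> (\<forall>t. R True w t \<longrightarrow> (\<forall>e s. R True t s \<longrightarrow> V 0 s [e]))" for w
    define H where "H w \<longleftrightarrow> (\<exists>u. R True w u \<and> (\<exists>d t. R True u t \<and>
      (\<forall>s. R True t s \<longrightarrow> (\<exists>r. R True s r \<and> \<not> V 0 r [d]) \<or> A s) \<and> \<not> A t))" for w
    have "A w" if "\<not> H w" for w
    proof (rule ccontr)
      assume "\<not> A w"
      then obtain v where v: "v = w \<or> S w v" "\<not> A v" "\<And>u. S v u \<Longrightarrow> A u"
        using last_point[of "\<lambda>v. \<not> A v" w] by metis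
      then obtain d where d: "\<not> V 0 v [d]" unfolding A_def R_def by blast
      have "R True w v" "R True v v" using v(1) by (auto simp: R_def)
      moreover have "A s" if "R True v s" "\<forall>r. R True s r \<longrightarrow> V 0 r [d]" for s
        using v(3) d that unfolding R_def by blast
      ultimately show False using \<open>\<not> H w\<close> v(2) unfolding H_def by blast
    qed
    moreover have "sem (R True) V w g (goedel casari) \<longleftrightarrow> (\<forall>v. R True w v \<longrightarrow> H v \<or> A v)"
      by (simp add: casari_def Let_def A_def H_def)
    ultimately show ?thesis by blast
  qed
  then show ?thesis by (simp add: valid_def)
qed

text \<open>Induction on \<open>m\<close> shows \<open>bd m\<close> at points of rank at most
  \<open>m\<close>. Strict successors satisfy the inner formula, so only the point itself could
  witness the diamond, and there the box yields its argument by reflexivity. The lower bound on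
  ranks makes points of rank 1 terminal.\<close>

lemma bd_valid:
  assumes "\<And>w. w \<in> W \<Longrightarrow> 1 \<le> rk w \<and> rk w \<le> n"
  shows "bd n \<in> uvalid W (R rx)"
proof -
  have "w \<in> W \<Longrightarrow> rk w \<le> m \<Longrightarrow> usem (R rx) V w (bd m)" for w m V
  proof (induction m arbitrary: w rule: bd.induct)
    case 1
    then show ?case using assms[of w] by simp
  next
    case 2
    then have "\<not> S w v" for v using assms[of v] S_W[of w v] S_rk[of w v] by auto
    then show ?case by (auto simp: R_def)
  next
    case (3 m)
    have "usem (R rx) V v (bd (Suc m))" if "S w v" for v
      using 3 that S_W S_rk[of w v] by (intro "3.IH") auto
    then show ?case by (cases rx) (auto simp: R_def[of _ w])
  qed
  then show ?thesis using assms by (auto simp: uvalid_def)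
qed

end

section \<open>Canonical models of monadic logics\<close>

lemma K_plus_mono: "K_plus {} \<subseteq> K_plus \<Gamma>"
  unfolding K_plus_def by blast

lemma in_K_plus: "(\<And>L. normal_logic L \<Longrightarrow> \<Gamma> \<subseteq> L \<Longrightarrow> \<phi> \<in> L) \<Longrightarrow> \<phi> \<in> K_plus \<Gamma>"
  unfolding K_plus_def by blast

abbreviation box_of :: "(bfm \<Rightarrow> bfm) \<Rightarrow> bfm \<Rightarrow> bfm" where
  "box_of d \<phi> \<equiv> BNot (d (BNot \<phi>))"

text \<open>Only K, S5 and the two commutation axioms are fixed. One canonical model construction
  thus serves all four logics, and also the set of formulas translated into a predicate
  logic.\<close>

locale monadic_logic =
  fixes M :: "bfm set"
  assumes closed: "bclosed M"
    and K_sub: "in_dia ` K_plus {} \<subseteq> M"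
    and S5_sub: "in_ex ` S5 \<subseteq> M"
    and commute_ex_dia: "BEx (BDia (BVar 0)) \<rightarrow>\<^sub>B BDia (BEx (BVar 0)) \<in> M"
    and commute_dia_ex: "BDia (BEx (BVar 0)) \<rightarrow>\<^sub>B BEx (BDia (BVar 0)) \<in> M"
begin

lemmas closed_conjuncts = closed[unfolded bclosed_def]
lemmas mp = closed_conjuncts[THEN conjunct1, rule_format]
  and subst = closed_conjuncts[THEN conjunct2, THEN conjunct1, rule_format]
  and nec_box = closed_conjuncts[THEN conjunct2, THEN conjunct2, THEN conjunct1, rule_format]
  and nec_all = closed_conjuncts[THEN conjunct2, THEN conjunct2, THEN conjunct2, rule_format]

lemma K_instance: "\<phi> \<in> K_plus {} \<Longrightarrow> bsubst s (in_dia \<phi>) \<in> M"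
  using K_sub by (intro subst) blast

lemma S5_instance: "\<phi> \<in> S5 \<Longrightarrow> bsubst s (in_ex \<phi>) \<in> M"
  using S5_sub by (intro subst) blast

lemma taut_instance: "utautology \<phi> \<Longrightarrow> bsubst s (in_dia \<phi>) \<in> M"
  by (rule K_instance, rule in_K_plus) (simp add: normal_logic_def)

lemma ax_weaken: "\<phi> \<rightarrow>\<^sub>B \<psi> \<rightarrow>\<^sub>B \<phi> \<in> M"
  using taut_instance[of "UVar 0 \<rightarrow>\<^sub>U UVar 1 \<rightarrow>\<^sub>U UVar 0" "\<lambda>i. if i = 0 then \<phi> else \<psi>"]
  by (simp add: utautology_def)

lemma ax_distrib: "(\<phi> \<rightarrow>\<^sub>B \<psi> \<rightarrow>\<^sub>B \<chi>) \<rightarrow>\<^sub>B (\<phi> \<rightarrow>\<^sub>B \<psi>) \<rightarrow>\<^sub>B \<phi> \<rightarrow>\<^sub>B \<chi> \<in> M"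
  using taut_instance[of "(UVar 0 \<rightarrow>\<^sub>U UVar 1 \<rightarrow>\<^sub>U UVar 2) \<rightarrow>\<^sub>U (UVar 0 \<rightarrow>\<^sub>U UVar 1) \<rightarrow>\<^sub>U UVar 0 \<rightarrow>\<^sub>U UVar 2"
      "\<lambda>i. if i = 0 then \<phi> else if i = 1 then \<psi> else \<chi>"]
  by (simp add: utautology_def)

lemma ax_dne: "BNot (BNot \<phi>) \<rightarrow>\<^sub>B \<phi> \<in> M"
  using taut_instance[of "UNot (UNot (UVar 0)) \<rightarrow>\<^sub>U UVar 0" "\<lambda>i. \<phi>"]
  by (simp add: utautology_def)

text \<open>Local consequence: necessitation applies to theorems only, whence the deduction
  theorem.\<close>

inductive der :: "bfm set \<Rightarrow> bfm \<Rightarrow> bool" for \<Gamma> where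
  ax: "\<phi> \<in> M \<Longrightarrow> der \<Gamma> \<phi>"
| hyp: "\<phi> \<in> \<Gamma> \<Longrightarrow> der \<Gamma> \<phi>"
| der_mp: "der \<Gamma> (\<phi> \<rightarrow>\<^sub>B \<psi>) \<Longrightarrow> der \<Gamma> \<phi> \<Longrightarrow> der \<Gamma> \<psi>"

lemma der_mono: "der \<Gamma> \<phi> \<Longrightarrow> \<Gamma> \<subseteq> \<Delta> \<Longrightarrow> der \<Delta> \<phi>"
  by (induction rule: der.induct) (auto intro: der.intros)

lemma der_empty: "der {} \<phi> \<Longrightarrow> \<phi> \<in> M"
proof (induction rule: der.induct)
  case (der_mp \<phi> \<psi>)
  then show ?case using mp[of \<phi> \<psi>] by simp
qed auto

lemma der_K: "der \<Gamma> \<psi> \<Longrightarrow> der \<Gamma> (\<phi> \<rightarrow>\<^sub>B \<psi>)"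
  by (rule der_mp[OF ax[OF ax_weaken]])

lemma der_S: "der \<Gamma> (\<phi> \<rightarrow>\<^sub>B \<psi> \<rightarrow>\<^sub>B \<chi>) \<Longrightarrow> der \<Gamma> (\<phi> \<rightarrow>\<^sub>B \<psi>) \<Longrightarrow> der \<Gamma> (\<phi> \<rightarrow>\<^sub>B \<chi>)"
  by (rule der_mp[OF der_mp[OF ax[OF ax_distrib]]])

lemma der_refl: "der \<Gamma> (\<phi> \<rightarrow>\<^sub>B \<phi>)"
  by (rule der_S[of _ _ "\<phi> \<rightarrow>\<^sub>B \<phi>"]) (rule ax, rule ax_weaken)+

lemma deduction: "der (insert \<phi> \<Gamma>) \<psi> \<Longrightarrow> der \<Gamma> (\<phi> \<rightarrow>\<^sub>B \<psi>)"
proof (induction rule: der.induct)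
  case (ax \<psi>)
  then show ?case by (intro der_K der.ax)
next
  case (hyp \<psi>)
  then show ?case using der_refl der_K der.hyp by blast
next
  case (der_mp \<psi> \<chi>)
  then show ?case using der_S by blast
qed

text \<open>A derivation uses finitely many hypotheses, so a single member of the chain contains
  them all. This provides the upper bounds for Zorn's lemma.\<close>

lemma der_chain:
  assumes "der (\<Union> C) \<phi>" and "C \<noteq> {}" and "subset.chain UNIV C"
  shows "\<exists>\<Gamma>\<in>C. der \<Gamma> \<phi>"
  using assms(1)
proof (induction rule: der.induct)
  case (ax \<phi>)
  then show ?case using assms(2) der.ax by blast
next
  case (hyp \<phi>)
  then show ?case using der.hyp by blast
next
  case (der_mp \<phi> \<psi>)
  then obtain \<Gamma> \<Delta> where *: "\<Gamma> \<in> C" "der \<Gamma> (\<phi> \<rightarrow>\<^sub>B \<psi>)" "\<Delta> \<in> C" "der \<Delta> \<phi>" by blast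
  then have "\<Gamma> \<subseteq> \<Delta> \<or> \<Delta> \<subseteq> \<Gamma>"
    using assms(3) unfolding subset_chain_def by blast
  then show ?case using * der_mono der.der_mp by metis
qed

section \<open>Maximal consistent sets\<close>

definition mcs :: "bfm set \<Rightarrow> bool" where
  "mcs x \<longleftrightarrow> \<not> der x BBot \<and> (\<forall>\<phi>. \<phi> \<notin> x \<longrightarrow> der (insert \<phi> x) BBot)"

lemma lindenbaum:
  assumes "\<not> der \<Gamma> BBot"
  obtains x where "mcs x" "\<Gamma> \<subseteq> x"
proof -
  let ?A = "{\<Delta>. \<Gamma> \<subseteq> \<Delta> \<and> \<not> der \<Delta> BBot}"
  have "\<exists>x\<in>?A. \<forall>y\<in>?A. x \<subseteq> y \<longrightarrow> y = x"
  proof (rule subset_Zorn_nonempty)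
    show "?A \<noteq> {}" using assms by blast
    fix C assume C: "C \<noteq> {}" "subset.chain ?A C"
    then have "C \<subseteq> ?A" "subset.chain UNIV C" by (auto simp: subset_chain_def)
    moreover have "\<not> der (\<Union> C) BBot"
      using der_chain[of C BBot] C(1) calculation by blast
    ultimately show "\<Union> C \<in> ?A" using C(1) by blast
  qed
  then obtain x where x: "x \<in> ?A" and max: "\<forall>y\<in>?A. x \<subseteq> y \<longrightarrow> y = x" by (rule bexE)
  have "der (insert \<phi> x) BBot" if "\<phi> \<notin> x" for \<phi>
  proof (rule ccontr)
    assume "\<not> der (insert \<phi> x) BBot"
    with x have "insert \<phi> x \<in> ?A" by blast
    with max that show False by blast
  qed
  with x have "mcs x" by (simp add: mcs_def)
  then show thesis using that x by simp
qed

lemma mcs_der: "mcs x \<Longrightarrow> der x \<phi> \<longleftrightarrow> \<phi> \<in> x"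
  using deduction der.hyp der.der_mp unfolding mcs_def by metis

lemma mcs_M: "mcs x \<Longrightarrow> \<phi> \<in> M \<Longrightarrow> \<phi> \<in> x"
  using mcs_der der.ax by metis

lemma mcs_bot [simp]: "mcs x \<Longrightarrow> BBot \<notin> x"
  using mcs_der mcs_def by metis

lemma mcs_imp [simp]:
  assumes "mcs x"
  shows "(\<phi> \<rightarrow>\<^sub>B \<psi>) \<in> x \<longleftrightarrow> (\<phi> \<in> x \<longrightarrow> \<psi> \<in> x)"
proof -
  have mp: "\<psi> \<in> x" if "(\<phi> \<rightarrow>\<^sub>B \<psi>) \<in> x" "\<phi> \<in> x" for \<phi> \<psi>
    using that der.der_mp der.hyp mcs_der[OF assms] by metis
  have neg: "BNot \<phi> \<in> x" if "\<phi> \<notin> x"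
    using that assms deduction mcs_der[OF assms] unfolding mcs_def by metis
  have "der (insert \<phi> {BNot \<phi>}) BBot"
    by (rule der.der_mp[of _ \<phi>]) (auto intro: der.hyp)
  moreover have "der (insert \<phi> {BNot \<phi>}) (BBot \<rightarrow>\<^sub>B \<psi>)"
    by (rule deduction, rule der.der_mp[OF ax[OF ax_dne]], rule der_K) (auto intro: der.hyp)
  ultimately have "der {BNot \<phi>} (\<phi> \<rightarrow>\<^sub>B \<psi>)"
    using der.der_mp deduction by blast
  then have "(\<phi> \<rightarrow>\<^sub>B \<psi>) \<in> x" if "BNot \<phi> \<in> x"
    using that der_mono[of "{BNot \<phi>}" _ x] mcs_der[OF assms] by blast
  moreover have "(\<phi> \<rightarrow>\<^sub>B \<psi>) \<in> x" if "\<psi> \<in> x"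
    using that der_K der.hyp mcs_der[OF assms] by metis
  ultimately show ?thesis using mp neg by blast
qed

lemma mcs_separate:
  assumes "\<phi> \<notin> M"
  obtains x where "mcs x" "\<phi> \<notin> x"
proof -
  have "\<not> der {BNot \<phi>} BBot"
    using assms deduction[of "BNot \<phi>" "{}" BBot] der_empty mp ax_dne by blast
  then obtain x where "mcs x" "{BNot \<phi>} \<subseteq> x" by (rule lindenbaum)
  then show thesis using that[of x] by auto
qed

lemma M_iff: "\<phi> \<in> M \<longleftrightarrow> (\<forall>x. mcs x \<longrightarrow> \<phi> \<in> x)"
  using mcs_M mcs_separate by metis

text \<open>Treats both modalities at once. The last clause stands in for duality: it lets the box
  of a negation be read as the negation of \<open>d\<close>.\<close>

definition normal_op :: "(bfm \<Rightarrow> bfm) \<Rightarrow> bool" where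
  "normal_op d \<longleftrightarrow> (\<forall>\<phi>\<in>M. box_of d \<phi> \<in> M)
     \<and> (\<forall>\<phi> \<psi>. box_of d (\<phi> \<rightarrow>\<^sub>B \<psi>) \<rightarrow>\<^sub>B box_of d \<phi> \<rightarrow>\<^sub>B box_of d \<psi> \<in> M)
     \<and> (\<forall>x \<phi>. mcs x \<longrightarrow> (d (BNot (BNot \<phi>)) \<in> x \<longleftrightarrow> d \<phi> \<in> x))"

definition rel :: "(bfm \<Rightarrow> bfm) \<Rightarrow> bfm set \<Rightarrow> bfm set \<Rightarrow> bool" where
  "rel d x y \<longleftrightarrow> mcs y \<and> (\<forall>\<phi>. box_of d \<phi> \<in> x \<longrightarrow> \<phi> \<in> y)"

lemma rel_mcs: "rel d x y \<Longrightarrow> mcs y"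
  by (simp add: rel_def)

lemma rel_iff:
  assumes "normal_op d" "mcs x" "mcs y"
  shows "rel d x y \<longleftrightarrow> (\<forall>\<phi>\<in>y. d \<phi> \<in> x)"
proof
  assume "rel d x y"
  show "\<forall>\<phi>\<in>y. d \<phi> \<in> x"
  proof (rule ballI, rule ccontr)
    fix \<phi> assume "\<phi> \<in> y" "d \<phi> \<notin> x"
    then have "box_of d (BNot \<phi>) \<in> x" using assms unfolding normal_op_def by simp
    then have "BNot \<phi> \<in> y" using \<open>rel d x y\<close> unfolding rel_def by blast
    then show False using \<open>\<phi> \<in> y\<close> assms(3) by simp
  qed
next
  assume *: "\<forall>\<phi>\<in>y. d \<phi> \<in> x"
  show "rel d x y"
    unfolding rel_def
  proof (intro conjI allI impI assms(3))
    fix \<phi> assume "box_of d \<phi> \<in> x"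
    then show "\<phi> \<in> y" using *[rule_format, of "BNot \<phi>"] assms by auto
  qed
qed

lemma der_box_of:
  assumes "normal_op d" "mcs x" "der {\<psi>. box_of d \<psi> \<in> x} \<phi>"
  shows "box_of d \<phi> \<in> x"
  using assms(3)
proof (induction rule: der.induct)
  case (ax \<phi>)
  then show ?case using assms mcs_M unfolding normal_op_def by blast
next
  case (der_mp \<phi> \<psi>)
  have "box_of d (\<phi> \<rightarrow>\<^sub>B \<psi>) \<rightarrow>\<^sub>B box_of d \<phi> \<rightarrow>\<^sub>B box_of d \<psi> \<in> x"
    using assms mcs_M unfolding normal_op_def by blast
  then show ?case using der_mp.IH assms(2) by simp
qed simp

lemma mem_op:
  assumes "normal_op d" "mcs x"
  shows "d \<phi> \<in> x \<longleftrightarrow> (\<exists>y. rel d x y \<and> \<phi> \<in> y)"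
proof
  assume "d \<phi> \<in> x"
  then have "box_of d (BNot \<phi>) \<notin> x" using assms unfolding normal_op_def by simp
  then have "\<not> der {\<psi>. box_of d \<psi> \<in> x} (BNot \<phi>)" using der_box_of assms by blast
  then have "\<not> der (insert \<phi> {\<psi>. box_of d \<psi> \<in> x}) BBot" using deduction by blast
  then obtain y where "mcs y" "insert \<phi> {\<psi>. box_of d \<psi> \<in> x} \<subseteq> y" by (rule lindenbaum)
  then show "\<exists>y. rel d x y \<and> \<phi> \<in> y" unfolding rel_def by blast
next
  assume "\<exists>y. rel d x y \<and> \<phi> \<in> y"
  then show "d \<phi> \<in> x" using rel_iff assms rel_mcs by blast
qed

lemma op_mono:
  assumes "normal_op d" "\<phi> \<rightarrow>\<^sub>B \<psi> \<in> M"
  shows "d \<phi> \<rightarrow>\<^sub>B d \<psi> \<in> M"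
  unfolding M_iff
proof (intro allI impI)
  fix x assume x: "mcs x"
  have "\<psi> \<in> y" if "rel d x y" "\<phi> \<in> y" for y
    using mcs_M[OF rel_mcs assms(2)] that rel_mcs mcs_imp by blast
  then show "(d \<phi> \<rightarrow>\<^sub>B d \<psi>) \<in> x" using mem_op[OF assms(1) x] x by auto
qed

text \<open>Finitely many members of \<open>B\<close> are used, and since \<open>B\<close> is
  directed one member provably implies all of them.\<close>

lemma der_union:
  assumes "der (A \<union> B) \<phi>" and "B \<noteq> {}"
    and meet: "\<And>\<beta> \<gamma>. \<beta> \<in> B \<Longrightarrow> \<gamma> \<in> B \<Longrightarrow> \<exists>\<delta>\<in>B. \<delta> \<rightarrow>\<^sub>B \<beta> \<in> M \<and> \<delta> \<rightarrow>\<^sub>B \<gamma> \<in> M"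
  shows "\<exists>\<beta>\<in>B. der A (\<beta> \<rightarrow>\<^sub>B \<phi>)"
  using assms(1)
proof (induction rule: der.induct)
  case (ax \<phi>)
  then show ?case using assms(2) der_K der.ax by blast
next
  case (hyp \<phi>)
  then show ?case using assms(2) der_K der.hyp der_refl by blast
next
  case (der_mp \<phi> \<psi>)
  then obtain \<beta> \<gamma> where \<beta>: "\<beta> \<in> B" "der A (\<beta> \<rightarrow>\<^sub>B \<phi> \<rightarrow>\<^sub>B \<psi>)" "\<gamma> \<in> B" "der A (\<gamma> \<rightarrow>\<^sub>B \<phi>)" by blast
  with meet obtain \<delta> where \<delta>: "\<delta> \<in> B" "\<delta> \<rightarrow>\<^sub>B \<beta> \<in> M" "\<delta> \<rightarrow>\<^sub>B \<gamma> \<in> M" by blast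
  have "der A (\<delta> \<rightarrow>\<^sub>B \<phi> \<rightarrow>\<^sub>B \<psi>)" using der_S[OF der_K[OF \<beta>(2)] der.ax[OF \<delta>(2)]] .
  moreover have "der A (\<delta> \<rightarrow>\<^sub>B \<phi>)" using der_S[OF der_K[OF \<beta>(4)] der.ax[OF \<delta>(3)]] .
  ultimately show ?case using der_S \<delta>(1) by blast
qed

text \<open>\<open>w\<close> has to extend \<open>?A\<close> and the image of \<open>z\<close> under
  \<open>d\<close>. Conjunctions in \<open>z\<close> make this image directed, so an inconsistency
  would involve a single \<open>d \<chi>\<close> and exclude \<open>e (d \<chi>)\<close> from
  \<open>x\<close>. But \<open>e \<chi>\<close> is in \<open>y\<close>, hence
  \<open>d (e \<chi>)\<close> is in \<open>x\<close>, and \<open>com\<close> applies.\<close>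

lemma rel_commute:
  assumes d: "normal_op d" "normal_op e"
    and com: "\<And>\<phi>. d (e \<phi>) \<rightarrow>\<^sub>B e (d \<phi>) \<in> M"
    and x: "mcs x" "rel d x y" "rel e y z"
  obtains w where "rel e x w" "rel d w z"
proof -
  have y: "mcs y" and z: "mcs z" using x rel_mcs by blast+
  let ?A = "{\<psi>. box_of e \<psi> \<in> x}" and ?B = "d ` z"
  have "\<not> der (?A \<union> ?B) BBot"
  proof
    assume "der (?A \<union> ?B) BBot"
    moreover have "z \<noteq> {}" using mcs_M[OF z ax_dne] by blast
    moreover have "\<exists>\<delta>\<in>?B. \<delta> \<rightarrow>\<^sub>B \<beta> \<in> M \<and> \<delta> \<rightarrow>\<^sub>B \<gamma> \<in> M" if "\<beta> \<in> ?B" "\<gamma> \<in> ?B" for \<beta> \<gamma>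
    proof -
      from that obtain \<beta>' \<gamma>' where *: "\<beta> = d \<beta>'" "\<gamma> = d \<gamma>'" "\<beta>' \<in> z" "\<gamma>' \<in> z" by blast
      let ?c = "BNot (\<beta>' \<rightarrow>\<^sub>B BNot \<gamma>')"
      have "?c \<rightarrow>\<^sub>B \<beta>' \<in> M" "?c \<rightarrow>\<^sub>B \<gamma>' \<in> M" unfolding M_iff by simp_all
      then have "d ?c \<rightarrow>\<^sub>B \<beta> \<in> M" "d ?c \<rightarrow>\<^sub>B \<gamma> \<in> M"
        unfolding * using op_mono[OF d(1)] by simp_all
      moreover have "d ?c \<in> ?B" using * z by simp
      ultimately show ?thesis by blast
    qed
    ultimately obtain \<chi> where \<chi>: "\<chi> \<in> z" "der ?A (BNot (d \<chi>))"
      using der_union[of ?A ?B BBot] by blast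
    then have "box_of e (BNot (d \<chi>)) \<in> x" using der_box_of d x by blast
    then have "e (d \<chi>) \<notin> x" using d(2) x(1) unfolding normal_op_def by simp
    moreover have "e \<chi> \<in> y" using \<chi> x y z rel_iff d by blast
    then have "d (e \<chi>) \<in> x" using x y rel_iff d by blast
    ultimately show False using mcs_M[OF x(1) com[of \<chi>]] x(1) by simp
  qed
  then obtain w where w: "mcs w" "?A \<union> ?B \<subseteq> w" by (rule lindenbaum)
  then have "rel e x w" unfolding rel_def by blast
  moreover have "rel d w z" using rel_iff[OF d(1) w(1) z] w(2) by blast
  ultimately show thesis using that by blast
qed

lemma normal_op_dia: "normal_op BDia"
  unfolding normal_op_def
proof (intro conjI allI impI ballI)
  fix \<phi> \<psi>
  show "BBox (\<phi> \<rightarrow>\<^sub>B \<psi>) \<rightarrow>\<^sub>B BBox \<phi> \<rightarrow>\<^sub>B BBox \<psi> \<in> M"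
    using K_instance[OF in_K_plus, of ax_K "\<lambda>i. if i = 0 then \<phi> else \<psi>"]
    by (simp add: normal_logic_def ax_K_def)
next
  fix x \<phi> assume "mcs x"
  then show "BDia (BNot (BNot \<phi>)) \<in> x \<longleftrightarrow> BDia \<phi> \<in> x"
    using mcs_M[OF _ K_instance[OF in_K_plus], of x ax_Dual "\<lambda>i. \<phi>"]
    by (auto simp: normal_logic_def ax_Dual_def)
qed (rule nec_box)

lemma in_S5: "(\<And>L. normal_logic L \<Longrightarrow> \<phi> \<in> L) \<Longrightarrow> \<phi> \<in> S5"
  unfolding S5_def by (rule in_K_plus) simp

lemma normal_op_ex: "normal_op BEx"
  unfolding normal_op_def
proof (intro conjI allI impI ballI)
  fix \<phi> \<psi>
  show "BAll (\<phi> \<rightarrow>\<^sub>B \<psi>) \<rightarrow>\<^sub>B BAll \<phi> \<rightarrow>\<^sub>B BAll \<psi> \<in> M"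
    using S5_instance[OF in_S5, of ax_K "\<lambda>i. if i = 0 then \<phi> else \<psi>"]
    by (simp add: normal_logic_def ax_K_def)
next
  fix x \<phi> assume "mcs x"
  then show "BEx (BNot (BNot \<phi>)) \<in> x \<longleftrightarrow> BEx \<phi> \<in> x"
    using mcs_M[OF _ S5_instance[OF in_S5], of x ax_Dual "\<lambda>i. \<phi>"]
    by (auto simp: normal_logic_def ax_Dual_def)
qed (rule nec_all)

section \<open>The canonical relations of the two modalities\<close>

abbreviation "R \<equiv> rel BDia"
abbreviation "E \<equiv> rel BEx"

lemmas mem_dia [simp] = mem_op[OF normal_op_dia]
  and mem_ex [simp] = mem_op[OF normal_op_ex]

lemma R_mcs [simp]: "R x y \<Longrightarrow> mcs y" and E_mcs [simp]: "E x y \<Longrightarrow> mcs y"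
  using rel_mcs by blast+

lemma S5_axioms:
  shows "UBox (UVar 0) \<rightarrow>\<^sub>U UVar 0 \<in> S5"
    and "UBox (UVar 0) \<rightarrow>\<^sub>U UBox (UBox (UVar 0)) \<in> S5"
    and "UDia (UVar 0) \<rightarrow>\<^sub>U UBox (UDia (UVar 0)) \<in> S5"
  unfolding S5_def by (rule in_K_plus, simp)+

lemma E_refl: 
  assumes "mcs x" shows "E x x"
proof -
  have "\<phi> \<in> x" if "BAll \<phi> \<in> x" for \<phi>
    using mcs_M[OF assms S5_instance[OF S5_axioms(1), of "\<lambda>i. \<phi>"]] that assms
    by simp
  then show ?thesis using assms unfolding rel_def by blast
qed

lemma E_trans:
  assumes "mcs x" "E x y" "E y z" shows "E x z"
proof -
  have "BAll \<phi> \<in> y" if "BAll \<phi> \<in> x" for \<phi>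
    using mcs_M[OF assms(1) S5_instance[OF S5_axioms(2), of "\<lambda>i. \<phi>"]] that assms(1,2)
    by simp
  then show ?thesis using assms(3) unfolding rel_def by blast
qed

lemma E_sym:
  assumes "mcs x" "E x y" shows "E y x"
proof -
  have "BEx \<phi> \<in> y" if "\<phi> \<in> x" for \<phi>
    using mcs_M[OF assms(1) S5_instance[OF S5_axioms(3), of "\<lambda>i. \<phi>"]]
      that assms E_refl[OF assms(1)]
    by simp blast
  then show ?thesis using rel_iff[OF normal_op_ex E_mcs[OF assms(2)] assms(1)] by blast
qed

lemma ER:
  assumes "mcs x" "E x y" "R y z"
  obtains w where "R x w" "E w z"
proof -
  have "BEx (BDia \<phi>) \<rightarrow>\<^sub>B BDia (BEx \<phi>) \<in> M" for \<phi>
    using subst[OF commute_ex_dia, of "\<lambda>_. \<phi>"] by simp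
  from rel_commute[OF normal_op_ex normal_op_dia this assms that] show thesis .
qed

lemma RE:
  assumes "mcs x" "R x y" "E y z"
  obtains w where "E x w" "R w z"
proof -
  have "BDia (BEx \<phi>) \<rightarrow>\<^sub>B BEx (BDia \<phi>) \<in> M" for \<phi>
    using subst[OF commute_dia_ex, of "\<lambda>_. \<phi>"] by simp
  from rel_commute[OF normal_op_dia normal_op_ex this assms that] show thesis .
qed

end

section \<open>Definability and types\<close>

text \<open>The constraint that a transitive \<open>R\<close> puts on the types of two related
  points. The disjunct with \<open>BDia \<chi> \<in> t'\<close> makes \<open>compat\<close> itself
  transitive.\<close>

definition compat :: "bfm set \<Rightarrow> bfm set \<Rightarrow> bfm set \<Rightarrow> bool" where
  "compat S t t' \<longleftrightarrow> (\<forall>\<chi>. BDia \<chi> \<in> S \<longrightarrow> \<chi> \<in> t' \<or> BDia \<chi> \<in> t' \<longrightarrow> BDia \<chi> \<in> t)"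

lemma compat_trans: "compat S t t' \<Longrightarrow> compat S t' t'' \<Longrightarrow> compat S t t''"
  by (auto simp: compat_def)

text \<open>In the reflexive case a point whose type contains \<psi> witnesses its own diamond,
  which is then no defect.\<close>

definition defect :: "bool \<Rightarrow> bfm set \<Rightarrow> bfm \<Rightarrow> bool" where
  "defect rx t \<psi> \<longleftrightarrow> BDia \<psi> \<in> t \<and> \<not> (rx \<and> \<psi> \<in> t)"

definition repair :: "bfm set \<Rightarrow> bfm set set set \<Rightarrow> bfm set set \<Rightarrow> bfm set \<Rightarrow> bfm \<Rightarrow> bool" where
  "repair S G T t \<psi> \<longleftrightarrow> (\<exists>T'\<in>G. (\<exists>t'\<in>T'. \<psi> \<in> t' \<and> compat S t t') \<and>
     (\<forall>s\<in>T. \<exists>s'\<in>T'. compat S s s') \<and> (\<forall>s'\<in>T'. \<exists>s\<in>T. compat S s s'))"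

lemma repair_mono: "repair S G T t \<psi> \<Longrightarrow> G \<subseteq> H \<Longrightarrow> repair S H T t \<psi>"
  unfolding repair_def by blast

definition labels :: "bfm set \<Rightarrow> (bfm set \<times> bfm) set" where
  "labels S = Pow S \<times> S"

context monadic_logic
begin

text \<open>The axioms speak of formulas only. To find maximal points of a region by GL, Grz or
  Casari's axiom, the region must be defined by a formula on all points.\<close>

definition definable :: "(bfm set \<Rightarrow> bool) \<Rightarrow> bool" where
  "definable P \<longleftrightarrow> (\<exists>\<psi>. \<forall>x. mcs x \<longrightarrow> (P x \<longleftrightarrow> \<psi> \<in> x))"

lemma definable_mem: "definable (\<lambda>x. \<psi> \<in> x)"
  unfolding definable_def by blast

lemma definable_imp:
  assumes "definable P" "definable Q"
  shows "definable (\<lambda>x. P x \<longrightarrow> Q x)"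
proof -
  obtain \<phi> \<psi> where "\<And>x. mcs x \<Longrightarrow> P x \<longleftrightarrow> \<phi> \<in> x" "\<And>x. mcs x \<Longrightarrow> Q x \<longleftrightarrow> \<psi> \<in> x"
    using assms unfolding definable_def by metis
  then have "\<forall>x. mcs x \<longrightarrow> ((P x \<longrightarrow> Q x) \<longleftrightarrow> (\<phi> \<rightarrow>\<^sub>B \<psi>) \<in> x)" by simp
  then show ?thesis unfolding definable_def ..
qed

lemma definable_False: "definable (\<lambda>x. False)"
  unfolding definable_def by (rule exI[of _ BBot]) simp

lemma definable_not: "definable P \<Longrightarrow> definable (\<lambda>x. \<not> P x)"
  using definable_imp[OF _ definable_False, of P] by simp

lemma definable_True: "definable (\<lambda>x. True)"
  using definable_not[OF definable_False] by simp

lemma definable_conj: "definable P \<Longrightarrow> definable Q \<Longrightarrow> definable (\<lambda>x. P x \<and> Q x)"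
  using definable_not[OF definable_imp[OF _ definable_not], of P Q] by simp

lemma definable_rel:
  assumes "normal_op d" "definable P"
  shows "definable (\<lambda>x. \<exists>y. rel d x y \<and> P y)"
proof -
  obtain \<phi> where "\<And>x. mcs x \<Longrightarrow> P x \<longleftrightarrow> \<phi> \<in> x"
    using assms(2) unfolding definable_def by blast
  then have "\<forall>x. mcs x \<longrightarrow> ((\<exists>y. rel d x y \<and> P y) \<longleftrightarrow> d \<phi> \<in> x)"
    using mem_op[OF assms(1)] rel_mcs by blast
  then show ?thesis unfolding definable_def ..
qed

text \<open>This replaces a disjunctive normal form: the induction splits on the value of one
  \<open>P i\<close>, and each half is decided by the remaining properties.\<close>

lemma definable_finite:
  assumes "finite I" and "\<And>i. i \<in> I \<Longrightarrow> definable (P i)"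
    and "\<And>x y. mcs x \<Longrightarrow> mcs y \<Longrightarrow> \<forall>i\<in>I. P i x \<longleftrightarrow> P i y \<Longrightarrow> Q x \<longleftrightarrow> Q y"
  shows "definable Q"
  using assms
proof (induction I arbitrary: Q rule: finite_induct)
  case empty
  show ?case
  proof (cases "\<exists>x. mcs x \<and> Q x")
    case True
    then have "\<forall>x. mcs x \<longrightarrow> (Q x \<longleftrightarrow> True)" using empty by blast
    then show ?thesis using definable_True unfolding definable_def by simp
  next
    case False
    then have "\<forall>x. mcs x \<longrightarrow> (Q x \<longleftrightarrow> False)" by blast
    then show ?thesis using definable_False unfolding definable_def by simp
  qed
next
  case (insert i I)
  \<comment> \<open>\<open>Q' b\<close> freezes the value of \<open>P i\<close> to \<open>b\<close>.
    Passing to some point \<open>y\<close> that agrees on \<open>I\<close> makes it depend on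
    \<open>I\<close> alone, as the induction hypothesis demands.\<close>
  define Q' where "Q' b x \<longleftrightarrow> (\<exists>y. mcs y \<and> P i y = b \<and> (\<forall>j\<in>I. P j x \<longleftrightarrow> P j y) \<and> Q y)" for b x
  have "definable (Q' b)" for b
    by (rule insert.IH) (use insert.prems(1) in \<open>auto simp: Q'_def\<close>)
  moreover have "definable (P i)" using insert.prems(1) by simp
  ultimately have "definable (\<lambda>x. (P i x \<longrightarrow> Q' True x) \<and> (\<not> P i x \<longrightarrow> Q' False x))"
    by (intro definable_conj definable_imp definable_not)
  moreover have "Q x \<longleftrightarrow> (P i x \<longrightarrow> Q' True x) \<and> (\<not> P i x \<longrightarrow> Q' False x)" if "mcs x" for x
  proof -
    have "Q x \<longleftrightarrow> Q' (P i x) x"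
      unfolding Q'_def using insert.prems(2)[OF that] that by (metis insert_iff)
    then show ?thesis by (cases "P i x") simp_all
  qed
  ultimately show ?case unfolding definable_def by simp
qed

section \<open>Types of a class\<close>

definition types :: "bfm set \<Rightarrow> bfm set \<Rightarrow> bfm set set" where
  "types S x = {y \<inter> S |y. E x y}"

lemma types_eq:
  assumes "mcs x" "E x y" shows "types S x = types S y"
proof -
  have "types S v \<subseteq> types S u" if "mcs u" "E u v" for u v
    using E_trans[OF that] unfolding types_def by blast
  then show ?thesis using assms E_sym[OF assms] E_mcs[OF assms(2)] by (intro equalityI)
qed

lemma self_types: "mcs x \<Longrightarrow> x \<inter> S \<in> types S x"
  unfolding types_def using E_refl by blast

lemma definable_type: "finite S \<Longrightarrow> definable (\<lambda>x. P (x \<inter> S))"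
proof (rule definable_finite[of S "\<lambda>\<chi> x. \<chi> \<in> x"])
  fix x y assume "\<forall>\<chi>\<in>S. \<chi> \<in> x \<longleftrightarrow> \<chi> \<in> y"
  then have "x \<inter> S = y \<inter> S" by blast
  then show "P (x \<inter> S) = P (y \<inter> S)" by simp
qed (simp_all add: definable_mem)

text \<open>The set of types is determined by which of the finitely many subsets of \<open>S\<close>
  are realized in the class, and each of these conditions is an \<exists>-formula over a definable
  one.\<close>

lemma definable_types:
  assumes "finite S" shows "definable (\<lambda>x. P (types S x))"
proof (rule definable_finite[of "Pow S" "\<lambda>t x. \<exists>y. E x y \<and> y \<inter> S = t"])
  show "definable (\<lambda>x. \<exists>y. E x y \<and> y \<inter> S = t)" for t
    using definable_rel[OF normal_op_ex definable_type[OF assms, of "\<lambda>s. s = t"]] .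
next
  fix x y assume *: "\<forall>t\<in>Pow S. (\<exists>z. E x z \<and> z \<inter> S = t) \<longleftrightarrow> (\<exists>z. E y z \<and> z \<inter> S = t)"
  have "types S x = {t. t \<in> Pow S \<and> (\<exists>z. E x z \<and> z \<inter> S = t)}" for x
    unfolding types_def by blast
  moreover have "{t. t \<in> Pow S \<and> (\<exists>z. E x z \<and> z \<inter> S = t)} = {t. t \<in> Pow S \<and> (\<exists>z. E y z \<and> z \<inter> S = t)}"
    using * by (intro Collect_cong) blast
  ultimately have "types S x = types S y" by simp
  then show "P (types S x) = P (types S y)" by simp
qed (use assms in simp)

definition repairable :: "bool \<Rightarrow> bfm set \<Rightarrow> bfm set set set \<Rightarrow> bfm set set set" where
  "repairable rx S G = {T. (\<exists>x. mcs x \<and> T = types S x) \<and> (\<forall>t\<in>T. \<forall>\<psi>. defect rx t \<psi> \<longrightarrow> repair S G T t \<psi>)}"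

text \<open>A label \<open>(t, \<psi>)\<close> names the defect \<open>\<diamond>\<psi>\<close> of a type \<open>t\<close>. A broken point carries a defect that no
  class of \<open>G\<close> repairs; blocking spreads this over the \<open>E\<close>-class.\<close>

definition broken :: "bool \<Rightarrow> bfm set \<Rightarrow> bfm set set set \<Rightarrow> bfm set \<times> bfm \<Rightarrow> bfm set \<Rightarrow> bool" where
  "broken rx S G \<delta> x \<longleftrightarrow> x \<inter> S = fst \<delta> \<and> defect rx (fst \<delta>) (snd \<delta>) \<and> \<not> repair S G (types S x) (fst \<delta>) (snd \<delta>)"

lemma definable_broken:
  assumes "finite S" shows "definable (broken rx S G \<delta>)"
proof -
  have "definable (\<lambda>x. b)" for b
    using definable_True definable_False by (cases b) simp_all
  with assms show ?thesis
    unfolding broken_def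
    by (intro definable_conj definable_type[of S "\<lambda>t. t = fst \<delta>"]
        definable_types[of S "\<lambda>T. \<not> repair S G T (fst \<delta>) (snd \<delta>)"])
qed

definition blocked :: "bool \<Rightarrow> bfm set \<Rightarrow> bfm set set set \<Rightarrow> bfm set \<times> bfm \<Rightarrow> bfm set \<Rightarrow> bool" where
  "blocked rx S G \<delta> x \<longleftrightarrow> (\<exists>y. E x y \<and> broken rx S G \<delta> y)"

lemma definable_blocked: "finite S \<Longrightarrow> definable (blocked rx S G \<delta>)"
  using definable_rel[OF normal_op_ex definable_broken, of S rx G \<delta>] unfolding blocked_def .

lemma blocked_E:
  assumes "mcs x" "E x y" "blocked rx S G \<delta> x"
  shows "blocked rx S G \<delta> y"
proof -
  obtain z where "E x z" "broken rx S G \<delta> z" using assms(3) unfolding blocked_def by blast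
  then show ?thesis
    using E_trans[OF E_mcs[OF assms(2)] E_sym[OF assms(1,2)]] unfolding blocked_def by blast
qed

lemma obtain_blocked:
  assumes "mcs x" "types S x \<notin> repairable rx S G" and "\<And>\<psi>. BDia \<psi> \<in> S \<Longrightarrow> \<psi> \<in> S"
  obtains \<delta> where "\<delta> \<in> labels S" "blocked rx S G \<delta> x"
proof -
  obtain t \<psi> where t: "t \<in> types S x" "defect rx t \<psi>" "\<not> repair S G (types S x) t \<psi>"
    using assms(1,2) unfolding repairable_def by blast
  then obtain y where y: "E x y" "t = y \<inter> S" unfolding types_def by blast
  have "broken rx S G (t, \<psi>) y"
    using t y types_eq[OF assms(1) y(1), of S] by (simp add: broken_def)
  then have "blocked rx S G (t, \<psi>) x" using y(1) unfolding blocked_def by blast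
  moreover have "(t, \<psi>) \<in> labels S" using t(2) y(2) assms(3) unfolding labels_def defect_def by blast
  ultimately show thesis using that by blast
qed

text \<open>The class of \<open>y\<close> itself is the repairing set: \<open>ER\<close> gives
  totality, \<open>RE\<close> surjectivity, and transitivity of \<open>R\<close> gives
  \<open>compat\<close>. Contrapositively, a successor witnessing an unrepaired defect has its class
  outside \<open>G\<close>.\<close>

lemma repair_R:
  assumes R_trans: "\<forall>x y z. mcs x \<longrightarrow> R x y \<longrightarrow> R y z \<longrightarrow> R x z"
    and x: "mcs x" "R x y" "\<psi> \<in> y" "\<psi> \<in> S" "types S y \<in> G"
  shows "repair S G (types S x) (x \<inter> S) \<psi>"
proof -
  have compat: "compat S (u \<inter> S) (v \<inter> S)" if "mcs u" "R u v" for u v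
    unfolding compat_def
  proof (intro allI impI)
    fix \<chi> assume "BDia \<chi> \<in> S" "\<chi> \<in> v \<inter> S \<or> BDia \<chi> \<in> v \<inter> S"
    moreover have "\<exists>w. R u w \<and> \<chi> \<in> w" if "BDia \<chi> \<in> v"
      using that mem_dia[OF R_mcs] R_trans \<open>mcs u\<close> \<open>R u v\<close> by blast
    ultimately show "BDia \<chi> \<in> u \<inter> S" using mem_dia[OF \<open>mcs u\<close>] \<open>R u v\<close> by blast
  qed
  show ?thesis
    unfolding repair_def
  proof (intro bexI[of _ "types S y"] conjI ballI)
    show "\<exists>t'\<in>types S y. \<psi> \<in> t' \<and> compat S (x \<inter> S) t'"
      using compat[OF x(1,2)] self_types[OF R_mcs[OF x(2)]] x(3,4) by blast
  next
    fix s assume "s \<in> types S x"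
    then obtain u where u: "E x u" "s = u \<inter> S" unfolding types_def by blast
    have "mcs u" "E u x" using E_mcs[OF u(1)] E_sym[OF x(1) u(1)] .
    from ER[OF this x(2)] obtain v where "R u v" "E v y" .
    then show "\<exists>s'\<in>types S y. compat S s s'"
      using compat[OF \<open>mcs u\<close>] E_sym[OF R_mcs] u(2) unfolding types_def by blast
  next
    fix s' assume "s' \<in> types S y"
    then obtain v where v: "E y v" "s' = v \<inter> S" unfolding types_def by blast
    from RE[OF x(1,2) v(1)] obtain u where "E x u" "R u v" .
    then show "\<exists>s\<in>types S x. compat S s s'"
      using compat[OF E_mcs] v(2) unfolding types_def by blast
  qed (rule x(5))
qed

end

section \<open>Progress\<close>

context monadic_logic
begin

lemma dia_instance: "\<phi> \<in> L \<Longrightarrow> in_dia ` L \<subseteq> M \<Longrightarrow> mcs x \<Longrightarrow> bsubst s (in_dia \<phi>) \<in> x"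
  by (rule mcs_M, assumption, rule subst) blast

lemma mem_box: "mcs x \<Longrightarrow> BBox \<phi> \<in> x \<longleftrightarrow> (\<forall>y. R x y \<longrightarrow> \<phi> \<in> y)"
  and mem_all: "mcs x \<Longrightarrow> BAll \<phi> \<in> x \<longleftrightarrow> (\<forall>y. E x y \<longrightarrow> \<phi> \<in> y)"
  by auto

lemma GL_axiom: "UBox (UBox (UVar 0) \<rightarrow>\<^sub>U UVar 0) \<rightarrow>\<^sub>U UBox (UVar 0) \<in> GL"
  unfolding GL_def by (rule in_K_plus) simp

lemma Grz_axiom: "UBox (UBox (UVar 0 \<rightarrow>\<^sub>U UBox (UVar 0)) \<rightarrow>\<^sub>U UVar 0) \<rightarrow>\<^sub>U UVar 0 \<in> Grz"
  unfolding Grz_def by (rule in_K_plus) simp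

text \<open>A class that cannot be repaired in \<open>G\<close> sees a step \<open>R c u\<close> that leaves the blocked region of
  some label for good while staying outside \<open>G\<close>.\<close>

definition progress :: "bool \<Rightarrow> bool" where
  "progress rx \<longleftrightarrow> (\<forall>S G x. finite S \<longrightarrow> (\<forall>\<psi>. BDia \<psi> \<in> S \<longrightarrow> \<psi> \<in> S) \<longrightarrow> mcs x \<longrightarrow> types S x \<notin> repairable rx S G \<longrightarrow>
     (\<exists>\<delta>\<in>labels S. \<exists>c u. (c = x \<or> R x c) \<and> blocked rx S G \<delta> c \<and> R c u \<and> types S u \<notin> G \<and>
        (\<forall>b. b = u \<or> R u b \<longrightarrow> \<not> blocked rx S G \<delta> b)))"

section \<open>Progress from the Loeb axiom\<close>

lemma GL_instance:
  assumes "in_dia ` GL \<subseteq> M" and "mcs x"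
  shows "BBox (BBox \<phi> \<rightarrow>\<^sub>B \<phi>) \<rightarrow>\<^sub>B BBox \<phi> \<in> x"
  using dia_instance[OF GL_axiom assms, of "\<lambda>_. \<phi>"] by (simp del: mem_dia mcs_imp)

lemma GL_trans:
  assumes GL: "in_dia ` GL \<subseteq> M" and x: "mcs x" "R x y" "R y z"
  shows "R x z"
proof -
  have "\<phi> \<in> z" if *: "BBox \<phi> \<in> x" for \<phi>
  proof -
    have p: "\<phi> \<in> u" if "R x u" for u using that * unfolding rel_def by blast
    \<comment> \<open>Loeb's axiom is applied to \<phi> \<and> \<box>\<phi>, the classical
      derivation of transitivity.\<close>
    let ?q = "BNot (\<phi> \<rightarrow>\<^sub>B BNot (BBox \<phi>))"
    have "BBox (BBox ?q \<rightarrow>\<^sub>B ?q) \<in> x" using x(1) p by simp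
    then have "BBox ?q \<in> x" using GL_instance[OF GL x(1), of ?q] mcs_imp[OF x(1)] by blast
    then have "?q \<in> y" using x(2) unfolding rel_def by blast
    then have "BBox \<phi> \<in> y" using x(2) by simp
    then show ?thesis using x(3) unfolding rel_def by blast
  qed
  then show ?thesis using R_mcs[OF x(3)] unfolding rel_def by blast
qed

text \<open>Loeb's axiom for the formula defining the complement of \<open>P\<close>, read
  contrapositively: a successor that lacks it yields one that lacks it while all further successors
  have it.\<close>

lemma GL_max:
  assumes GL: "in_dia ` GL \<subseteq> M" and "definable P" and x: "mcs x" "R x y" "P y"
  obtains z where "R x z" "P z" "\<forall>u. R z u \<longrightarrow> \<not> P u"
proof -
  obtain \<phi> where \<phi>: "\<And>x. mcs x \<Longrightarrow> \<not> P x \<longleftrightarrow> \<phi> \<in> x"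
    using definable_not[OF assms(2)] unfolding definable_def by blast
  have "BBox \<phi> \<notin> x" using x(2,3) \<phi>[OF R_mcs[OF x(2)]] unfolding rel_def by blast
  then have "BBox (BBox \<phi> \<rightarrow>\<^sub>B \<phi>) \<notin> x"
    using GL_instance[OF GL x(1), of \<phi>] mcs_imp[OF x(1)] by blast
  then obtain z where z: "R x z" "\<phi> \<notin> z" "\<And>u. R z u \<Longrightarrow> \<phi> \<in> u"
    using x(1) by auto
  show thesis
  proof (rule that[OF z(1)])
    show "P z" using z(2) \<phi>[OF R_mcs[OF z(1)]] by blast
    have "\<not> P u" if "R z u" for u using z(3) that \<phi>[OF R_mcs[OF that]] by blast
    then show "\<forall>u. R z u \<longrightarrow> \<not> P u" by blast
  qed
qed

text \<open>\<open>c\<close> is a last point at or above \<open>x\<close> whose class is blocked by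
  \<delta>. A broken member \<open>z\<close> of that class has a successor witnessing the defect,
  and the class of this successor is outside \<open>G\<close>, since otherwise it would be a
  repair.\<close>

lemma progress_GL:
  assumes GL: "in_dia ` GL \<subseteq> M"
  shows "progress False"
  unfolding progress_def
proof (intro allI impI)
  fix S G x
  assume S: "finite S" "\<forall>\<psi>. BDia \<psi> \<in> S \<longrightarrow> \<psi> \<in> S" and x: "mcs x" "types S x \<notin> repairable False S G"
  obtain \<delta> where \<delta>: "\<delta> \<in> labels S" "blocked False S G \<delta> x"
    using obtain_blocked[OF x] S(2) by blast
  obtain t \<psi> where t: "\<delta> = (t, \<psi>)" by (cases \<delta>)
  have trans: "\<forall>x y z. mcs x \<longrightarrow> R x y \<longrightarrow> R y z \<longrightarrow> R x z"
    using GL_trans[OF GL] by blast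
  obtain c where c: "c = x \<or> R x c" "blocked False S G \<delta> c" "\<And>u. R c u \<Longrightarrow> \<not> blocked False S G \<delta> u"
  proof (cases "\<exists>y. R x y \<and> blocked False S G \<delta> y")
    case True
    then obtain y where "R x y" "blocked False S G \<delta> y" by blast
    then obtain z where "R x z" "blocked False S G \<delta> z" "\<forall>u. R z u \<longrightarrow> \<not> blocked False S G \<delta> u"
      by (rule GL_max[OF GL definable_blocked[OF S(1)] x(1)])
    then show thesis using that[of z] by blast
  next
    case False
    then show thesis using that[of x] \<delta>(2) by blast
  qed
  have "mcs c" using c(1) x(1) R_mcs[of x c] by blast
  obtain z where z: "E c z" "broken False S G \<delta> z" using c(2) unfolding blocked_def by blast
  have "mcs z" using E_mcs[OF z(1)] .
  have "BDia \<psi> \<in> z" and "\<psi> \<in> S" and zt: "z \<inter> S = t" and no: "\<not> repair S G (types S z) t \<psi>"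
    using z(2) S(2) by (auto simp: broken_def defect_def t simp del: mem_dia)
  then obtain u where u: "R z u" "\<psi> \<in> u" using mem_dia[OF \<open>mcs z\<close>] by blast
  have "types S u \<notin> G"
    using repair_R[OF trans \<open>mcs z\<close> u \<open>\<psi> \<in> S\<close>, where G = G] no zt by blast
  \<comment> \<open>The witness \<open>u\<close> is a successor of \<open>z\<close>, whereas a
    successor of \<open>c\<close> is wanted; commuting the relations gives one in the same
    class.\<close>
  obtain v where v: "R c v" "E v u" using ER[OF \<open>mcs c\<close> z(1) u(1)] .
  have "types S v \<notin> G" using types_eq[OF R_mcs[OF v(1)] v(2)] \<open>types S u \<notin> G\<close> by simp
  moreover have "\<not> blocked False S G \<delta> b" if "b = v \<or> R v b" for b
    using that c(3) v(1) GL_trans[OF GL \<open>mcs c\<close> v(1)] by blast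
  ultimately show "\<exists>\<delta>\<in>labels S. \<exists>c u. (c = x \<or> R x c) \<and> blocked False S G \<delta> c \<and> R c u \<and> types S u \<notin> G \<and>
      (\<forall>b. b = u \<or> R u b \<longrightarrow> \<not> blocked False S G \<delta> b)"
    using \<delta>(1) c(1,2) v(1) by blast
qed

section \<open>Progress from Grz and Casari's axiom\<close>

lemma Grz_instance:
  assumes "in_dia ` Grz \<subseteq> M" and "mcs x"
  shows "BBox (BBox (\<phi> \<rightarrow>\<^sub>B BBox \<phi>) \<rightarrow>\<^sub>B \<phi>) \<rightarrow>\<^sub>B \<phi> \<in> x"
  using dia_instance[OF Grz_axiom assms, of "\<lambda>_. \<phi>"] by (simp del: mem_dia mcs_imp)

lemma Grz_refl:
  assumes Grz: "in_dia ` Grz \<subseteq> M" and x: "mcs x"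
  shows "R x x"
proof -
  have "\<phi> \<in> x" if *: "BBox \<phi> \<in> x" for \<phi>
  proof -
    have p: "\<phi> \<in> u" if "R x u" for u using that * unfolding rel_def by blast
    then show ?thesis using Grz_instance[OF Grz x, of \<phi>] x by simp
  qed
  then show ?thesis using x unfolding rel_def by blast
qed

lemma Grz_trans:
  assumes Grz: "in_dia ` Grz \<subseteq> M" and x: "mcs x" "R x y" "R y z"
  shows "R x z"
proof -
  have "\<phi> \<in> z" if *: "BBox \<phi> \<in> x" for \<phi>
  proof -
    have p: "\<phi> \<in> u" if "R x u" for u using that * unfolding rel_def by blast
    \<comment> \<open>Grz is applied to \<phi> \<and> (\<box>\<phi> \<rightarrow>
      \<box>\<box>\<phi>), whose truth at \<open>x\<close> turns \<box>\<phi> into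
      \<box>\<box>\<phi>.\<close>
    let ?q = "BNot (\<phi> \<rightarrow>\<^sub>B BNot (BBox \<phi> \<rightarrow>\<^sub>B BBox (BBox \<phi>)))"
    have q: "?q \<in> u \<longleftrightarrow> \<phi> \<in> u \<and> ((\<forall>v. R u v \<longrightarrow> \<phi> \<in> v) \<longrightarrow> (\<forall>v. R u v \<longrightarrow> (\<forall>w. R v w \<longrightarrow> \<phi> \<in> w)))"
      if "mcs u" for u
      using that by auto
    have "?q \<in> u" if "R x u" and H: "BBox (?q \<rightarrow>\<^sub>B BBox ?q) \<in> u" for u
    proof -
      have u: "mcs u" using R_mcs[OF \<open>R x u\<close>] .
      \<comment> \<open>If \<open>?q\<close> holds at \<open>v\<close>, it persists to
        \<open>w\<close> by \<open>H\<close>. If it does not, its second conjunct fails at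
        \<open>v\<close>, so \<box>\<phi> holds there.\<close>
      have step: "\<phi> \<in> w" if "\<forall>v. R u v \<longrightarrow> \<phi> \<in> v" "R u v" "R v w" for v w
      proof (cases "?q \<in> v")
        case True
        have "?q \<rightarrow>\<^sub>B BBox ?q \<in> v" using H \<open>R u v\<close> unfolding rel_def by blast
        then have "BBox ?q \<in> v" using True mcs_imp[OF R_mcs[OF \<open>R u v\<close>]] by blast
        then have "?q \<in> w" using \<open>R v w\<close> unfolding rel_def by blast
        then show ?thesis using q[OF R_mcs[OF \<open>R v w\<close>]] by blast
      next
        case False
        then show ?thesis using q[OF R_mcs[OF \<open>R u v\<close>]] that by blast
      qed
      show ?thesis using q[OF u] p[OF \<open>R x u\<close>] step by blast
    qed
    then have "(BBox (?q \<rightarrow>\<^sub>B BBox ?q) \<rightarrow>\<^sub>B ?q) \<in> u" if "R x u" for u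
      using that mcs_imp[OF R_mcs[OF that]] by blast
    then have "BBox (BBox (?q \<rightarrow>\<^sub>B BBox ?q) \<rightarrow>\<^sub>B ?q) \<in> x"
      using mem_box[OF x(1)] by blast
    then have "?q \<in> x" using Grz_instance[OF Grz x(1), of ?q] mcs_imp[OF x(1)] by blast
    then show ?thesis using q[OF x(1)] p x(2,3) by blast
  qed
  then show ?thesis using R_mcs[OF x(3)] unfolding rel_def by blast
qed

text \<open>Grz for the complement of \<open>P\<close>, read contrapositively. Reflexivity rules out
  a \<open>P\<close>-point without \<open>P\<close>-successors, so maximality here means that
  \<open>P\<close>, once left, is never regained.\<close>

lemma Grz_max:
  assumes Grz: "in_dia ` Grz \<subseteq> M" and "definable P" and x: "mcs x" "P x"
  obtains z where "R x z" "P z" "\<forall>u. R z u \<longrightarrow> \<not> P u \<longrightarrow> (\<forall>v. R u v \<longrightarrow> \<not> P v)"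
proof -
  obtain \<phi> where \<phi>: "\<And>x. mcs x \<Longrightarrow> \<not> P x \<longleftrightarrow> \<phi> \<in> x"
    using definable_not[OF assms(2)] unfolding definable_def by blast
  have "\<phi> \<notin> x" using x \<phi> by blast
  then have "BBox (BBox (\<phi> \<rightarrow>\<^sub>B BBox \<phi>) \<rightarrow>\<^sub>B \<phi>) \<notin> x"
    using Grz_instance[OF Grz x(1), of \<phi>] mcs_imp[OF x(1)] by blast
  then obtain z where z: "R x z" "\<phi> \<notin> z" "\<And>u v. R z u \<Longrightarrow> \<phi> \<in> u \<Longrightarrow> R u v \<Longrightarrow> \<phi> \<in> v"
    using x(1) by auto
  show thesis
  proof (rule that[OF z(1)])
    show "P z" using z(2) \<phi>[OF R_mcs[OF z(1)]] by blast
    have "\<not> P v" if "R z u" "\<not> P u" "R u v" for u v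
      using z(3) that \<phi>[OF R_mcs[OF \<open>R z u\<close>]] \<phi>[OF R_mcs[OF \<open>R u v\<close>]] by blast
    then show "\<forall>u. R z u \<longrightarrow> \<not> P u \<longrightarrow> (\<forall>v. R u v \<longrightarrow> \<not> P v)" by blast
  qed
qed

end

definition casari_axiom :: "bfm \<Rightarrow> bfm" where
  "casari_axiom p = BBox (BAll (BBox (BBox p \<rightarrow>\<^sub>B BBox (BAll p)) \<rightarrow>\<^sub>B BBox (BAll p))) \<rightarrow>\<^sub>B BBox (BAll p)"

context monadic_logic
begin

text \<open>The conclusion of Casari's axiom fails at \<open>x\<close>, hence so does its premise,
  and this failure is located at a point \<open>y\<close> in the class of a successor
  \<open>c\<close>. The last two facts are the antecedent true at \<open>y\<close> and the
  consequent false at \<open>y\<close>.\<close>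

lemma casari_max:
  assumes C: "casari_axiom (BVar 0) \<in> M" and "definable P" and x: "mcs x" "R x a" "E a b" "\<not> P b"
  obtains c y where "R x c" "E c y"
    "\<forall>u. R y u \<longrightarrow> (\<forall>v. R u v \<longrightarrow> P v) \<longrightarrow> (\<forall>v. R u v \<longrightarrow> (\<forall>w. E v w \<longrightarrow> P w))"
    "\<exists>v. R y v \<and> (\<exists>w. E v w \<and> \<not> P w)"
proof -
  obtain \<phi> where \<phi>: "\<And>x. mcs x \<Longrightarrow> P x \<longleftrightarrow> \<phi> \<in> x"
    using assms(2) unfolding definable_def by blast
  let ?H = "BBox \<phi> \<rightarrow>\<^sub>B BBox (BAll \<phi>)"
  have RA: "BBox (BAll \<phi>) \<in> y \<longleftrightarrow> (\<forall>v. R y v \<longrightarrow> (\<forall>w. E v w \<longrightarrow> P w))" if "mcs y" for y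
    unfolding mem_box[OF that] using mem_all[OF R_mcs] \<phi>[OF E_mcs] by blast
  have RP: "BBox \<phi> \<in> y \<longleftrightarrow> (\<forall>v. R y v \<longrightarrow> P v)" if "mcs y" for y
    unfolding mem_box[OF that] using \<phi>[OF R_mcs] by blast
  have "casari_axiom \<phi> \<in> x"
    using mcs_M[OF x(1) subst[OF C, of "\<lambda>_. \<phi>"]] by (simp add: casari_axiom_def del: mem_dia mem_ex mcs_imp)
  moreover have "BBox (BAll \<phi>) \<notin> x" using RA[OF x(1)] x(2-4) by blast
  ultimately have "BBox (BAll (BBox ?H \<rightarrow>\<^sub>B BBox (BAll \<phi>))) \<notin> x"
    unfolding casari_axiom_def mcs_imp[OF x(1), of "BBox (BAll (BBox ?H \<rightarrow>\<^sub>B BBox (BAll \<phi>)))"] by blast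
  then obtain c where c: "R x c" "BAll (BBox ?H \<rightarrow>\<^sub>B BBox (BAll \<phi>)) \<notin> c"
    unfolding mem_box[OF x(1)] by blast
  then obtain y where y: "E c y" "(BBox ?H \<rightarrow>\<^sub>B BBox (BAll \<phi>)) \<notin> y"
    unfolding mem_all[OF R_mcs[OF c(1)]] by blast
  have "mcs y" using E_mcs[OF y(1)] .
  have "BBox ?H \<in> y" and no: "BBox (BAll \<phi>) \<notin> y"
    using y(2) unfolding mcs_imp[OF \<open>mcs y\<close>, of "BBox ?H"] by blast+
  then have "BBox \<phi> \<in> u \<longrightarrow> BBox (BAll \<phi>) \<in> u" if "R y u" for u
    using mem_box[OF \<open>mcs y\<close>] that mcs_imp[OF R_mcs[OF that], of "BBox \<phi>"] by blast
  then show thesis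
    using that[OF c(1) y(1)] RA[OF \<open>mcs y\<close>] no RA[OF R_mcs] RP[OF R_mcs] by blast
qed

text \<open>Grz controls single points, but members of a class may leave the broken region at
  different times. Casari's axiom synchronizes them: above \<open>y\<close>, a cone free of
  \<open>Q\<close> meets only classes free of \<open>Q\<close>. By \<open>toQ'\<close> such a cone
  contains no blocked point either.\<close>

lemma progress_Grz:
  assumes Grz: "in_dia ` Grz \<subseteq> M" and C: "casari_axiom (BVar 0) \<in> M"
  shows "progress True"
  unfolding progress_def
proof (intro allI impI)
  fix S G x
  assume S: "finite S" "\<forall>\<psi>. BDia \<psi> \<in> S \<longrightarrow> \<psi> \<in> S" and x: "mcs x" "types S x \<notin> repairable True S G"
  obtain \<delta> where \<delta>: "\<delta> \<in> labels S" "blocked True S G \<delta> x"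
    using obtain_blocked[OF x] S(2) by blast
  obtain t \<psi> where t: "\<delta> = (t, \<psi>)" by (cases \<delta>)
  define Z where "Z = broken True S G \<delta>"
  \<comment> \<open>\<open>Q\<close>: the broken points that can never leave \<open>Z\<close> and come back. Casari's formula is applied to \<open>\<not> Q\<close>.\<close>
  define Q where "Q z \<longleftrightarrow> Z z \<and> (\<forall>u. R z u \<longrightarrow> \<not> Z u \<longrightarrow> (\<forall>v. R u v \<longrightarrow> \<not> Z v))" for z
  have dZ: "definable Z" unfolding Z_def by (rule definable_broken[OF S(1)])
  have "definable (\<lambda>z. Z z \<and> \<not> (\<exists>u. R z u \<and> \<not> Z u \<and> (\<exists>v. R u v \<and> Z v)))"
    by (intro definable_conj definable_not definable_rel[OF normal_op_dia] dZ)
  moreover have "(\<lambda>z. Z z \<and> \<not> (\<exists>u. R z u \<and> \<not> Z u \<and> (\<exists>v. R u v \<and> Z v))) = Q"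
    unfolding Q_def by blast
  ultimately have "definable Q" by simp
  note trans = Grz_trans[OF Grz] and refl = Grz_refl[OF Grz]
  have toQ: "\<exists>q. R z q \<and> Q q" if z: "mcs z" "Z z" for z
    by (rule Grz_max[OF Grz dZ z]) (use Q_def in blast)
  have toQ': "\<exists>a q. R y a \<and> E a q \<and> Q q" if y: "mcs y" "blocked True S G \<delta> y" for y
  proof -
    obtain z where z: "E y z" "Z z" using y(2) unfolding blocked_def Z_def by blast
    then obtain q where q: "R z q" "Q q" using toQ[OF E_mcs] by blast
    show ?thesis using ER[OF y(1) z(1) q(1)] q(2) by blast
  qed
  obtain a q where aq: "R x a" "E a q" "\<not> \<not> Q q" using toQ'[OF x(1) \<delta>(2)] by blast
  obtain d y where y: "R x d" "E d y"
    and closed: "\<forall>u. R y u \<longrightarrow> (\<forall>v. R u v \<longrightarrow> \<not> Q v) \<longrightarrow> (\<forall>v. R u v \<longrightarrow> (\<forall>w. E v w \<longrightarrow> \<not> Q w))"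
    and ex: "\<exists>v. R y v \<and> (\<exists>w. E v w \<and> \<not> \<not> Q w)"
    by (rule casari_max[OF C definable_not[OF \<open>definable Q\<close>] x(1) aq])
  have "mcs d" "mcs y" using R_mcs[OF y(1)] E_mcs[OF y(2)] .
  \<comment> \<open>By reflexivity \<open>closed\<close> applies to \<open>y\<close> itself: if the
    cone of \<open>y\<close> were free of \<open>Q\<close>, then \<open>ex\<close> would
    fail.\<close>
  obtain z where z: "R y z" "Q z" using closed ex refl[OF \<open>mcs y\<close>] by blast
  have "mcs z" using R_mcs[OF z(1)] .
  have "Z z" using z(2) Q_def by blast
  have "BDia \<psi> \<in> z" and "\<psi> \<in> S" and zt: "z \<inter> S = t" and no: "\<not> repair S G (types S z) t \<psi>" and \<psi>: "\<psi> \<notin> t"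
    using \<open>Z z\<close> S(2) by (auto simp: Z_def broken_def defect_def t simp del: mem_dia)
  then obtain u where u: "R z u" "\<psi> \<in> u" using mem_dia[OF \<open>mcs z\<close>] by blast
  have "mcs u" using R_mcs[OF u(1)] .
  have "types S u \<notin> G"
    using repair_R[OF _ \<open>mcs z\<close> u \<open>\<psi> \<in> S\<close>, where G = G] trans no zt by blast
  \<comment> \<open>Here the reflexive notion of defect enters: every point of \<open>Z\<close> has
    type \<open>t\<close>, which lacks \<psi>.\<close>
  have "\<not> Z u" using u(2) \<psi> \<open>\<psi> \<in> S\<close> by (auto simp: Z_def broken_def t)
  then have "\<forall>v. R u v \<longrightarrow> \<not> Q v" using z(2) u(1) Q_def by blast
  then have noQ: "\<forall>v. R u v \<longrightarrow> (\<forall>w. E v w \<longrightarrow> \<not> Q w)"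
    using closed trans[OF \<open>mcs y\<close> z(1) u(1)] by blast
  have no_blocked: "\<not> blocked True S G \<delta> b" if b: "R u b" for b
  proof
    assume "blocked True S G \<delta> b"
    then obtain e q where eq: "R b e" "E e q" "Q q" using toQ'[OF R_mcs[OF b]] by blast
    then show False using noQ trans[OF \<open>mcs u\<close> b eq(1)] by blast
  qed
  \<comment> \<open>\<open>z\<close> and \<open>u\<close> lie above \<open>y\<close>, which is only
    in the class of the successor \<open>d\<close> of \<open>x\<close>. Commuting twice carries them
    to \<open>c\<close> and \<open>v\<close>, in the same classes and above
    \<open>x\<close>.\<close>
  obtain c where c: "R d c" "E c z" using ER[OF \<open>mcs d\<close> y(2) z(1)] .
  have "mcs c" using R_mcs[OF c(1)] .
  obtain v where v: "R c v" "E v u" using ER[OF \<open>mcs c\<close> c(2) u(1)] .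
  have "mcs v" using R_mcs[OF v(1)] .
  have "R x c" using trans[OF x(1) y(1) c(1)] .
  moreover have "blocked True S G \<delta> c" using c(2) \<open>Z z\<close> unfolding blocked_def Z_def by blast
  moreover have "types S v \<notin> G" using types_eq[OF \<open>mcs v\<close> v(2)] \<open>types S u \<notin> G\<close> by simp
  moreover have "\<not> blocked True S G \<delta> b" if b: "R v b" for b
  proof
    assume bl: "blocked True S G \<delta> b"
    obtain e where e: "R u e" "E e b" using ER[OF \<open>mcs u\<close> E_sym[OF \<open>mcs v\<close> v(2)] b] .
    then show False
      using no_blocked[OF e(1)] blocked_E[OF R_mcs[OF b] E_sym[OF R_mcs[OF e(1)] e(2)] bl] by blast
  qed
  then have "\<not> blocked True S G \<delta> b" if "b = v \<or> R v b" for b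
    using that refl[OF \<open>mcs v\<close>] by blast
  ultimately show "\<exists>\<delta>\<in>labels S. \<exists>c u. (c = x \<or> R x c) \<and> blocked True S G \<delta> c \<and> R c u \<and> types S u \<notin> G \<and>
      (\<forall>b. b = u \<or> R u b \<longrightarrow> \<not> blocked True S G \<delta> b)"
    using \<delta>(1) v(1) by blast
qed

section \<open>Bounding the number of rounds\<close>

lemma progressD:
  assumes "progress rx" "finite S" "\<forall>\<psi>. BDia \<psi> \<in> S \<longrightarrow> \<psi> \<in> S" "mcs x" "types S x \<notin> repairable rx S G"
  obtains \<delta> c u where "\<delta> \<in> labels S" "c = x \<or> R x c" "blocked rx S G \<delta> c" "R c u" "types S u \<notin> G"
    "\<forall>b. b = u \<or> R u b \<longrightarrow> \<not> blocked rx S G \<delta> b"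
proof -
  from assms(1)[unfolded progress_def, THEN spec, THEN spec, THEN spec, THEN HOL.mp, THEN HOL.mp, THEN HOL.mp, THEN HOL.mp,
      OF assms(2-5)]
  show thesis using that by blast
qed

text \<open>All variables of \<open>bd k\<close> have index at most \<open>k\<close>, so
  \<open>m\<close> is fresh for it.\<close>

lemma bsubst_bd_cong: "k < m \<Longrightarrow> bsubst (\<sigma>(m := \<psi>)) (in_dia (bd k)) = bsubst \<sigma> (in_dia (bd k))"
  by (induction k rule: bd.induct) auto

text \<open>The steps provided by \<open>progress\<close> form a chain, and falsifying the \<open>i\<close>-th variable exactly on the
  blocked region of the \<open>i\<close>-th step refutes \<open>bd\<close>.\<close>

lemma bd_refuted:
  assumes prog: "progress rx" and S: "finite S" "\<forall>\<psi>. BDia \<psi> \<in> S \<longrightarrow> \<psi> \<in> S"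
    and R_trans: "\<forall>x y z. mcs x \<longrightarrow> R x y \<longrightarrow> R y z \<longrightarrow> R x z"
    and x: "mcs x" "types S x \<notin> (repairable rx S ^^ Suc k) {}"
  shows "\<exists>c \<sigma>. (c = x \<or> R x c) \<and> bsubst \<sigma> (in_dia (bd (Suc k))) \<notin> c"
  using x
proof (induction k arbitrary: x)
  case 0
  then have "types S x \<notin> repairable rx S {}" by simp
  then obtain \<delta> c u where "\<delta> \<in> labels S" and c: "c = x \<or> R x c" "blocked rx S {} \<delta> c" "R c u"
    and "types S u \<notin> {}" and c4: "\<forall>b. b = u \<or> R u b \<longrightarrow> \<not> blocked rx S {} \<delta> b"
    by (rule progressD[OF prog S \<open>mcs x\<close>])
  \<comment> \<open>\<psi> defines the complement of the blocked region: it fails at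
    \<open>c\<close> and holds at and above \<open>u\<close>, which refutes \<open>bd 1\<close> at
    \<open>c\<close>.\<close>
  obtain \<psi> where \<psi>: "\<And>z. mcs z \<Longrightarrow> \<not> blocked rx S {} \<delta> z \<longleftrightarrow> \<psi> \<in> z"
    using definable_not[OF definable_blocked[OF S(1)]] unfolding definable_def by blast
  have "mcs c" "mcs u" using c(1) \<open>mcs x\<close> R_mcs[of x c] R_mcs[OF c(3)] by blast+
  have "BBox \<psi> \<in> u" using mem_box[OF \<open>mcs u\<close>] \<psi>[OF R_mcs] c4 by blast
  then have "BDia (BBox \<psi>) \<in> c" using mem_dia[OF \<open>mcs c\<close>] c(3) by blast
  then have "(BDia (BBox \<psi>) \<rightarrow>\<^sub>B \<psi>) \<notin> c" using mcs_imp[OF \<open>mcs c\<close>] \<psi>[OF \<open>mcs c\<close>] c(2) by blast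
  then have "bsubst (\<lambda>_. \<psi>) (in_dia (bd (Suc 0))) \<notin> c" by (simp del: mem_dia mcs_imp)
  then show ?case using c(1) by blast
next
  case (Suc k)
  then have "types S x \<notin> repairable rx S ((repairable rx S ^^ Suc k) {})" by simp
  then obtain \<delta> c u where "\<delta> \<in> labels S" and c: "c = x \<or> R x c" "blocked rx S ((repairable rx S ^^ Suc k) {}) \<delta> c" "R c u"
    "types S u \<notin> (repairable rx S ^^ Suc k) {}"
    "\<forall>b. b = u \<or> R u b \<longrightarrow> \<not> blocked rx S ((repairable rx S ^^ Suc k) {}) \<delta> b"
    by (rule progressD[OF prog S \<open>mcs x\<close>])
  obtain \<psi> where \<psi>: "\<And>z. mcs z \<Longrightarrow> \<not> blocked rx S ((repairable rx S ^^ Suc k) {}) \<delta> z \<longleftrightarrow> \<psi> \<in> z"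
    using definable_not[OF definable_blocked[OF S(1)]] unfolding definable_def by blast
  have mcs: "mcs c" "mcs u" using c(1) \<open>mcs x\<close> R_mcs[of x c] R_mcs[OF c(3)] by blast+
  obtain c' \<sigma> where c': "c' = u \<or> R u c'" "bsubst \<sigma> (in_dia (bd (Suc k))) \<notin> c'"
    using Suc.IH[OF mcs(2) c(4)] by blast
  note trans = R_trans[rule_format]
  have R: "R c c'" and "mcs c'" using c' c(3) trans[OF mcs(1) c(3), of c'] R_mcs[of u c'] mcs(2) by blast+
  \<comment> \<open>\<open>c'\<close> is \<open>u\<close> or above it, and at \<open>u\<close> the
    blocked region has been left for good.\<close>
  have "\<psi> \<in> v" if "R c' v" for v
    using \<psi>[OF R_mcs[OF that]] c(5) c'(1) that trans[OF mcs(2) _ that] by blast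
  then have "BBox \<psi> \<in> c'" using mem_box[OF \<open>mcs c'\<close>] by blast
  define \<sigma>' where "\<sigma>' = \<sigma>(Suc (Suc k) := \<psi>)"
  have "bsubst \<sigma>' (in_dia (bd (Suc k))) \<notin> c'" using c'(2) by (simp add: \<sigma>'_def bsubst_bd_cong)
  with \<open>BBox \<psi> \<in> c'\<close> have "BNot (BBox \<psi> \<rightarrow>\<^sub>B BNot (BNot (bsubst \<sigma>' (in_dia (bd (Suc k)))))) \<in> c'" (is "?\<chi> \<in> _")
    using mcs_imp[OF \<open>mcs c'\<close>] mcs_bot[OF \<open>mcs c'\<close>] by blast
  then have "BDia ?\<chi> \<in> c" using mem_dia[OF mcs(1)] R by blast
  then have "(BDia ?\<chi> \<rightarrow>\<^sub>B \<psi>) \<notin> c" using mcs_imp[OF mcs(1)] \<psi>[OF mcs(1)] c(2) by blast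
  moreover have "bsubst \<sigma>' (in_dia (bd (Suc (Suc k)))) = (BDia ?\<chi> \<rightarrow>\<^sub>B \<psi>)"
    by (simp add: \<sigma>'_def)
  ultimately show ?case using c(1) by metis
qed

text \<open>Otherwise \<open>bd_refuted\<close> gives a point lacking a substitution instance of the
  theorem \<open>bd n\<close>.\<close>

lemma bounded:
  assumes prog: "progress rx" and S: "finite S" "\<forall>\<psi>. BDia \<psi> \<in> S \<longrightarrow> \<psi> \<in> S"
    and R_trans: "\<forall>x y z. mcs x \<longrightarrow> R x y \<longrightarrow> R y z \<longrightarrow> R x z"
    and n: "1 \<le> n" "in_dia (bd n) \<in> M" and x: "mcs x"
  shows "types S x \<in> (repairable rx S ^^ n) {}"
proof (rule ccontr)
  assume *: "types S x \<notin> (repairable rx S ^^ n) {}"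
  obtain k where k: "n = Suc k" using n(1) by (cases n) auto
  obtain c \<sigma> where c: "c = x \<or> R x c" "bsubst \<sigma> (in_dia (bd (Suc k))) \<notin> c"
    using bd_refuted[OF prog S R_trans x *[unfolded k]] by blast
  have "mcs c" using c(1) x R_mcs[of x c] by blast
  then show False using mcs_M[OF _ subst[OF n(2)]] c(2) k by blast
qed

lemma repairable_mono: "G \<subseteq> H \<Longrightarrow> repairable rx S G \<subseteq> repairable rx S H"
  unfolding repairable_def using repair_mono[of S G _ _ _ H] by blast

lemma repairable_pow_mono: "(repairable rx S ^^ k) {} \<subseteq> (repairable rx S ^^ Suc k) {}"
  by (induction k) (use repairable_mono in simp_all)

lemma repairable_subset: "repairable rx S G \<subseteq> Pow (Pow S)"
  unfolding repairable_def types_def by auto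

lemma repairable_pow_subset: "(repairable rx S ^^ k) {} \<subseteq> Pow (Pow S)"
  by (cases k) (simp_all add: repairable_subset)

text \<open>The stages increase inside the finite \<open>Pow (Pow S)\<close>, so two of them
  coincide and some \<open>G i\<close> is a fixpoint. From a class outside \<open>G i\<close>,
  \<open>progress\<close> would lead to another one outside with fewer labels blocked at or above
  it.\<close>

lemma unbounded:
  assumes prog: "progress rx" and S: "finite S" "\<forall>\<psi>. BDia \<psi> \<in> S \<longrightarrow> \<psi> \<in> S"
    and R_trans: "\<forall>x y z. mcs x \<longrightarrow> R x y \<longrightarrow> R y z \<longrightarrow> R x z"
  shows "\<exists>N. \<forall>x. mcs x \<longrightarrow> types S x \<in> (repairable rx S ^^ N) {}"
proof -
  define G where "G k = (repairable rx S ^^ k) {}" for k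
  have mono: "G i \<subseteq> G j" if "i \<le> j" for i j
    using lift_Suc_mono_le[of G, OF _ that] repairable_pow_mono by (simp add: G_def)
  have "G k \<subseteq> Pow (Pow S)" for k
    by (simp add: G_def repairable_pow_subset)
  then have "range G \<subseteq> Pow (Pow (Pow S))" by blast
  then have "finite (range G)" by (rule finite_subset) (simp add: S(1))
  then have "\<not> inj G" using finite_imageD[of G UNIV] infinite_UNIV_nat by blast
  then obtain i j where "i < j" "G i = G j" unfolding inj_def by (metis linorder_neqE_nat)
  moreover have "repairable rx S (G i) = G (Suc i)" by (simp add: G_def)
  ultimately have fp: "repairable rx S (G i) = G i" using mono[of "Suc i" j] mono[of i "Suc i"] by simp
  \<comment> \<open>At a fixpoint of \<open>repairable\<close>, each step strictly decreases the set of labels blocked somewhere above.\<close>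
  define lab where "lab x = {\<delta>\<in>labels S. \<exists>b. (b = x \<or> R x b) \<and> blocked rx S (G i) \<delta> b}" for x
  have fin: "finite (lab x)" for x using S(1) by (simp add: lab_def labels_def)
  have "types S x \<in> G i" if "mcs x" for x
    using that
  proof (induction "card (lab x)" arbitrary: x rule: less_induct)
    case less
    show ?case
    proof (rule ccontr)
      assume "types S x \<notin> G i"
      then have "types S x \<notin> repairable rx S (G i)" using fp by simp
      then obtain \<delta> c u where c: "\<delta> \<in> labels S" "c = x \<or> R x c" "blocked rx S (G i) \<delta> c" "R c u" "types S u \<notin> G i"
        "\<forall>b. b = u \<or> R u b \<longrightarrow> \<not> blocked rx S (G i) \<delta> b"
        by (rule progressD[OF prog S less.prems])
      note trans = R_trans[rule_format]
      have "R x u" using c(2,4) trans[OF less.prems _ c(4)] by blast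
      have "lab u \<subseteq> lab x" unfolding lab_def using \<open>R x u\<close> trans[OF less.prems \<open>R x u\<close>] by blast
      moreover have "\<delta> \<in> lab x" "\<delta> \<notin> lab u" unfolding lab_def using c by blast+
      ultimately have "card (lab u) < card (lab x)" using psubset_card_mono[OF fin] by blast
      then show False using less.hyps R_mcs[OF c(4)] c(5) by blast
    qed
  qed
  then show ?thesis unfolding G_def by blast
qed

end

section \<open>The countermodel\<close>

primrec sub :: "bfm \<Rightarrow> bfm set" where
  "sub (BVar i) = {BVar i}"
| "sub BBot = {BBot}"
| "sub (\<phi> \<rightarrow>\<^sub>B \<psi>) = insert (\<phi> \<rightarrow>\<^sub>B \<psi>) (sub \<phi> \<union> sub \<psi>)"
| "sub (BDia \<phi>) = insert (BDia \<phi>) (sub \<phi>)"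
| "sub (BEx \<phi>) = insert (BEx \<phi>) (sub \<phi>)"

lemma finite_sub: "finite (sub \<phi>)"
  by (induction \<phi>) auto

lemma sub_self: "\<phi> \<in> sub \<phi>"
  by (cases \<phi>) auto

lemma sub_imp: "\<psi> \<rightarrow>\<^sub>B \<chi> \<in> sub \<phi> \<Longrightarrow> \<psi> \<in> sub \<phi> \<and> \<chi> \<in> sub \<phi>"
  by (induction \<phi>) (auto simp: sub_self)

lemma sub_dia: "BDia \<psi> \<in> sub \<phi> \<Longrightarrow> \<psi> \<in> sub \<phi>"
  by (induction \<phi>) (auto simp: sub_self)

lemma sub_ex: "BEx \<psi> \<in> sub \<phi> \<Longrightarrow> \<psi> \<in> sub \<phi>"
  by (induction \<phi>) (auto simp: sub_self)

text \<open>Enumerate \<open>A\<close> by codes of pairs (i, j) and send the element with code (i,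
  j) to the i-th element of \<open>T\<close>; each i occurs with infinitely many j.\<close>

lemma spread:
  fixes A :: "nat set"
  assumes "infinite A" "countable T" "T \<noteq> {}"
  obtains h where "\<forall>a. h a \<in> T" "\<forall>t\<in>T. infinite {a \<in> A. h a = t}"
proof
  let ?h = "\<lambda>a. from_nat_into T (fst (prod_decode (to_nat_on A a)))"
  show "\<forall>a. ?h a \<in> T" using assms(3) by (simp add: from_nat_into)
  have "infinite {a \<in> A. ?h a = t}" if "t \<in> T" for t
  proof -
    from that obtain i where i: "from_nat_into T i = t"
      using from_nat_into_surj[OF assms(2)] by blast
    let ?e = "\<lambda>j. from_nat_into A (prod_encode (i, j))"
    have "inj ?e"
      using assms(1) by (simp add: inj_def from_nat_into_inj_infinite)
    moreover have "?e j \<in> {a \<in> A. ?h a = t}" for j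
      using assms(1) i infinite_imp_nonempty[OF assms(1)] by (simp add: from_nat_into)
    then have "range ?e \<subseteq> {a \<in> A. ?h a = t}" by blast
    ultimately show ?thesis unfolding infinite_iff_countable_subset by blast
  qed
  then show "\<forall>t\<in>T. infinite {a \<in> A. ?h a = t}" by blast
qed

text \<open>A function on \<open>nat\<close> represents a class of types together with the elements of the domain that
  realize each type. Since every type is realized infinitely often, there is room to split it
  along any total and surjective relation.\<close>

definition rich :: "(nat \<Rightarrow> 'a) \<Rightarrow> 'a set \<Rightarrow> bool" where
  "rich f T \<longleftrightarrow> range f = T \<and> (\<forall>t\<in>T. infinite (f -` {t}))"

lemma rich_exists:
  assumes "finite T" "T \<noteq> {}"
  obtains f where "rich f T"
proof -
  obtain h :: "nat \<Rightarrow> 'a" where h: "\<forall>a. h a \<in> T" "\<forall>t\<in>T. infinite {a \<in> UNIV. h a = t}"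
    by (rule spread[OF infinite_UNIV_nat countable_finite[OF assms(1)] assms(2)])
  have "t \<in> range h" if "t \<in> T" for t
    using h(2)[rule_format, OF that, THEN infinite_imp_nonempty] by blast
  with h(1) have "range h = T" by blast
  moreover have "h -` {t} = {a \<in> UNIV. h a = t}" for t by auto
  ultimately have "rich h T" using h(2) by (simp add: rich_def)
  then show thesis by (rule that)
qed

text \<open>Each fibre of \<open>f\<close> is infinite, so \<open>spread\<close> distributes it over
  its \<open>C\<close>-successors in \<open>T'\<close> with infinite parts. Every member of
  \<open>T'\<close> receives such a part because it has a \<open>C\<close>-predecessor in
  \<open>T\<close>.\<close>

lemma rich_step:
  assumes f: "rich f T" and T': "finite T'"
    and tot: "\<forall>s\<in>T. \<exists>s'\<in>T'. C s s'" and surj: "\<forall>s'\<in>T'. \<exists>s\<in>T. C s s'"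
    and d: "t' \<in> T'" "C (f d) t'"
  obtains f' where "rich f' T'" "\<And>e. C (f e) (f' e)" "f' d = t'"
proof -
  have "\<exists>h. (\<forall>a. h a \<in> {s'\<in>T'. C s s'}) \<and> (\<forall>s'\<in>{s'\<in>T'. C s s'}. infinite {a \<in> f -` {s}. h a = s'})"
    if s: "s \<in> T" for s
  proof -
    have inf: "infinite (f -` {s})" using f s unfolding rich_def by blast
    have "countable {s'\<in>T'. C s s'}" using T' by (simp add: countable_finite)
    moreover have "{s'\<in>T'. C s s'} \<noteq> {}" using tot s by blast
    ultimately obtain h where "\<forall>a. h a \<in> {s'\<in>T'. C s s'}"
      "\<forall>t\<in>{s'\<in>T'. C s s'}. infinite {a \<in> f -` {s}. h a = t}"
      by (rule spread[OF inf])
    then show ?thesis by blast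
  qed
  then obtain h where h: "\<And>s a. s \<in> T \<Longrightarrow> h s a \<in> T' \<and> C s (h s a)"
    "\<And>s s'. s \<in> T \<Longrightarrow> s' \<in> T' \<Longrightarrow> C s s' \<Longrightarrow> infinite {a \<in> f -` {s}. h s a = s'}"
    by simp metis
  have fT: "f e \<in> T" for e using f unfolding rich_def by blast
  \<comment> \<open>Prescribing the single value at \<open>d\<close> leaves infinite fibres
    infinite.\<close>
  define f' where "f' = (\<lambda>e. h (f e) e)(d := t')"
  have inf: "infinite (f' -` {s'})" if s': "s' \<in> T'" for s'
  proof
    obtain s where s: "s \<in> T" "C s s'" using surj s' by blast
    assume "finite (f' -` {s'})"
    then have "finite (insert d (f' -` {s'}))" by simp
    moreover have "{a \<in> f -` {s}. h s a = s'} \<subseteq> insert d (f' -` {s'})"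
      by (auto simp: f'_def)
    ultimately show False using h(2)[OF s(1) s' s(2)] finite_subset by blast
  qed
  have "range f' \<subseteq> T'" using h(1)[OF fT] d(1) by (auto simp: f'_def)
  moreover have "T' \<subseteq> range f'" using inf[THEN infinite_imp_nonempty] by blast
  ultimately have "rich f' T'" using inf unfolding rich_def by blast
  moreover have "C (f e) (f' e)" for e using h(1)[OF fT] d(2) by (simp add: f'_def)
  ultimately show thesis using that by (simp add: f'_def)
qed

section \<open>Worlds and the truth lemma\<close>

type_synonym world = "nat \<times> (nat \<Rightarrow> bfm set)"

context monadic_logic
begin

text \<open>The stage is stored with the function because the same set of types may belong to
  several stages.\<close>

definition worlds :: "bool \<Rightarrow> bfm set \<Rightarrow> nat \<Rightarrow> world set" where
  "worlds rx S N = {(k, f). k \<le> N \<and> (\<exists>T\<in>(repairable rx S ^^ k) {}. rich f T)}"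

definition above :: "bool \<Rightarrow> bfm set \<Rightarrow> nat \<Rightarrow> world \<Rightarrow> world \<Rightarrow> bool" where
  "above rx S N w v \<longleftrightarrow> v \<in> worlds rx S N \<and> fst v < fst w \<and> (\<forall>d. compat S (snd w d) (snd v d))"

lemma ranked_frame_worlds: "ranked_frame (worlds rx S N) (above rx S N) fst"
proof
  show "above rx S N u w" if "above rx S N u v" "above rx S N v w" for u v w
    using that compat_trans[of S "snd u d" "snd v d" "snd w d" for d] by (simp add: above_def)
qed (auto simp: above_def)

text \<open>Stage 0 is empty, so ranks start at 1. With this lower bound, \<open>bd_valid\<close>
  makes \<open>N\<close> rounds correspond to \<open>bd N\<close>.\<close>

lemma worlds_rank: "w \<in> worlds rx S N \<Longrightarrow> 1 \<le> fst w \<and> fst w \<le> N"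
  by (cases "fst w") (auto simp: worlds_def)

lemma world_types:
  assumes "w \<in> worlds rx S N"
  obtains k T x where "fst w = Suc k" "Suc k \<le> N" "T \<in> repairable rx S ((repairable rx S ^^ k) {})" "rich (snd w) T"
    "mcs x" "T = types S x"
proof -
  obtain T where T: "fst w \<le> N" "T \<in> (repairable rx S ^^ fst w) {}" "rich (snd w) T"
    using assms unfolding worlds_def by auto
  obtain k where k: "fst w = Suc k" using worlds_rank[OF assms] by (cases "fst w") auto
  have T': "T \<in> repairable rx S ((repairable rx S ^^ k) {})" using T(2) k by simp
  then obtain x where "mcs x" "T = types S x" unfolding repairable_def by blast
  then show thesis using that k T T' by simp
qed

lemma world_mem:
  assumes w: "w \<in> worlds rx S N"
  obtains y where "mcs y" "snd w d = y \<inter> S" "range (snd w) = types S y"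
proof -
  obtain k T x where x: "rich (snd w) T" "mcs x" "T = types S x"
    using world_types[OF w] by metis
  then have r: "range (snd w) = types S x" unfolding rich_def by blast
  then obtain y where "E x y" "snd w d = y \<inter> S" unfolding types_def by blast
  then show thesis using that[of y] E_mcs[of x y] r types_eq[OF x(2), of y S] by simp
qed

text \<open>A defect at a world of rank \<open>Suc k\<close> is repaired by a set of stage
  \<open>k\<close>. \<open>rich_step\<close> turns this set into a world in which the same
  individual \<open>d\<close> has the witnessing type.\<close>

lemma world_dia:
  assumes w: "w \<in> worlds rx S N" and D: "defect rx (snd w d) \<psi>" and S: "finite S"
  obtains v where "above rx S N w v" "\<psi> \<in> snd v d"
proof -
  obtain k T x where k: "fst w = Suc k" "Suc k \<le> N" and T: "T \<in> repairable rx S ((repairable rx S ^^ k) {})"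
    and rich: "rich (snd w) T" and "mcs x" "T = types S x"
    using w by (rule world_types)
  have "snd w d \<in> T" using rich unfolding rich_def by blast
  then have "repair S ((repairable rx S ^^ k) {}) T (snd w d) \<psi>" using T D unfolding repairable_def by blast
  then obtain T' t' where T': "T' \<in> (repairable rx S ^^ k) {}" and t': "t' \<in> T'" "\<psi> \<in> t'" "compat S (snd w d) t'"
    and tot: "\<forall>s\<in>T. \<exists>s'\<in>T'. compat S s s'" and surj: "\<forall>s'\<in>T'. \<exists>s\<in>T. compat S s s'"
    unfolding repair_def by blast
  have "T' \<subseteq> Pow S" using T' repairable_pow_subset by blast
  then have "finite T'" using S finite_subset by blast
  obtain f' where f': "rich f' T'" "\<And>e. compat S (snd w e) (f' e)" "f' d = t'"
    using rich_step[OF rich \<open>finite T'\<close> tot surj t'(1,3)] by blast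
  have "(k, f') \<in> worlds rx S N" using T' f'(1) k(2) unfolding worlds_def by auto
  then have "above rx S N w (k, f')" using f'(2) k(1) by (simp add: above_def)
  then show thesis using that[of "(k, f')"] f'(3) t'(2) by simp
qed

text \<open>An individual is a thread that picks one type at each world. Repairs provide witnesses
  for diamonds, and \<open>compat\<close>, or canonical reflexivity when \<open>w\<close> sees
  itself, gives the converse. The case of \<exists> works because \<open>snd w\<close> runs through
  a whole class of types.\<close>

lemma truth_lemma:
  assumes "inj l" and refl: "rx \<longrightarrow> (\<forall>y. mcs y \<longrightarrow> R y y)"
    and V: "V = (\<lambda>P w ds. \<exists>i. P = l i \<and> BVar i \<in> snd w (hd ds))"
  shows "\<chi> \<in> sub \<phi> \<Longrightarrow> w \<in> worlds rx (sub \<phi>) N \<Longrightarrow>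
    sem (opt_refl rx (above rx (sub \<phi>) N)) V w g (one_var x l \<chi>) \<longleftrightarrow> \<chi> \<in> snd w (g x)"
proof (induction \<chi> arbitrary: w g)
  case (BVar i)
  then show ?case using assms(1) by (auto simp: V inj_def)
next
  case BBot
  obtain y where "mcs y" "snd w (g x) = y \<inter> sub \<phi>" by (rule world_mem[OF BBot(2)])
  then show ?case by simp
next
  case (BImp \<psi> \<chi>)
  obtain y where "mcs y" "snd w (g x) = y \<inter> sub \<phi>" by (rule world_mem[OF BImp(4)])
  then show ?case using BImp sub_imp[OF BImp(3)] by simp
next
  case (BEx \<psi>)
  have S: "\<psi> \<in> sub \<phi>" using sub_ex[OF BEx(2)] .
  obtain y where y: "mcs y" "snd w (g x) = y \<inter> sub \<phi>" "range (snd w) = types (sub \<phi>) y"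
    by (rule world_mem[OF BEx(3)])
  have "(\<exists>d. \<psi> \<in> snd w d) \<longleftrightarrow> (\<exists>t\<in>range (snd w). \<psi> \<in> t)" by blast
  also have "\<dots> \<longleftrightarrow> (\<exists>z. E y z \<and> \<psi> \<in> z)" unfolding y(3) types_def using S by blast
  also have "\<dots> \<longleftrightarrow> BEx \<psi> \<in> y" using mem_ex[OF y(1)] by blast
  finally show ?case using BEx.IH[OF S BEx(3)] y(2) BEx(2) by simp
next
  case (BDia \<psi>)
  have S: "\<psi> \<in> sub \<phi>" using sub_dia[OF BDia(2)] .
  obtain y where y: "mcs y" "snd w (g x) = y \<inter> sub \<phi>" by (rule world_mem[OF BDia(3)])
  have "BDia \<psi> \<in> snd w (g x)" if v: "opt_refl rx (above rx (sub \<phi>) N) w v" and "\<psi> \<in> snd v (g x)" for v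
  proof (cases "above rx (sub \<phi>) N w v")
    case True
    then show ?thesis using that(2) BDia(2) by (auto simp: above_def compat_def)
  next
    case False
    then have "rx" "v = w" using v by (auto simp: opt_refl_def)
    then have "R y y" "\<psi> \<in> y" using refl y that(2) by auto
    then show ?thesis using mem_dia[OF y(1)] y(2) BDia(2) by blast
  qed
  moreover have "\<exists>v. opt_refl rx (above rx (sub \<phi>) N) w v \<and> \<psi> \<in> snd v (g x)" if "BDia \<psi> \<in> snd w (g x)"
  proof (cases "rx \<and> \<psi> \<in> snd w (g x)")
    case True
    then show ?thesis by (intro exI[of _ w]) (simp add: opt_refl_def)
  next
    case False
    then have "defect rx (snd w (g x)) \<psi>" using that by (simp add: defect_def)
    then obtain v where "above rx (sub \<phi>) N w v" "\<psi> \<in> snd v (g x)"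
      by (rule world_dia[OF BDia(3) _ finite_sub])
    then show ?thesis unfolding opt_refl_def by blast
  qed
  moreover have "v \<in> worlds rx (sub \<phi>) N" if "opt_refl rx (above rx (sub \<phi>) N) w v" for v
    using that BDia(3) by (auto simp: opt_refl_def above_def)
  ultimately show ?case
    unfolding one_var.simps sem.simps using BDia.IH[OF S] by blast
qed

lemma countermodel:
  assumes "inj l" and refl: "rx \<longrightarrow> (\<forall>y. mcs y \<longrightarrow> R y y)"
    and N: "\<And>x. mcs x \<Longrightarrow> types (sub \<phi>) x \<in> (repairable rx (sub \<phi>) ^^ N) {}"
    and "\<phi> \<notin> M"
  shows "one_var x l \<phi> \<notin> valid (worlds rx (sub \<phi>) N) (opt_refl rx (above rx (sub \<phi>) N))"
proof -
  let ?S = "sub \<phi>"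
  obtain y where y: "mcs y" "\<phi> \<notin> y" by (rule mcs_separate[OF assms(4)])
  have "types ?S y \<subseteq> Pow ?S" unfolding types_def by blast
  then have "finite (types ?S y)" by (rule finite_subset) (simp add: finite_sub)
  moreover have "types ?S y \<noteq> {}" using self_types[OF y(1)] by blast
  ultimately obtain f where f: "rich f (types ?S y)" by (rule rich_exists)
  then have w: "(N, f) \<in> worlds rx ?S N" using N[OF y(1)] unfolding worlds_def by auto
  have "y \<inter> ?S \<in> range f" using f self_types[OF y(1), of ?S] by (simp add: rich_def)
  then obtain d where d: "f d = y \<inter> ?S" by (elim rangeE) simp
  define V where "V = (\<lambda>P (w :: world) ds. \<exists>i. P = l i \<and> BVar i \<in> snd w (hd ds))"
  have "sem (opt_refl rx (above rx ?S N)) V (N, f) (\<lambda>_. d) (one_var x l \<phi>) \<longleftrightarrow> \<phi> \<in> snd (N, f) d"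
    by (rule truth_lemma[OF assms(1) refl V_def sub_self w])
  then have "\<not> sem (opt_refl rx (above rx ?S N)) V (N, f) (\<lambda>_. d) (one_var x l \<phi>)"
    using d y(2) by simp
  then show ?thesis using w unfolding valid_def by blast
qed

end

section \<open>One-variable fragments\<close>

lemma bclosed_Inter:
  assumes "\<And>M. M \<in> C \<Longrightarrow> bclosed M"
  shows "bclosed (\<Inter> C)"
proof -
  note closed = assms[unfolded bclosed_def]
  show ?thesis
    unfolding bclosed_def
  proof (intro conjI allI impI InterI)
    fix \<phi> \<psi> M assume "\<phi> \<rightarrow>\<^sub>B \<psi> \<in> \<Inter> C" "\<phi> \<in> \<Inter> C" "M \<in> C"
    then show "\<psi> \<in> M" using closed[OF \<open>M \<in> C\<close>, THEN conjunct1, rule_format, of \<phi> \<psi>] by simp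
  qed (use closed in simp_all)
qed

lemma bclosed_bplus: "bclosed (bplus M \<Gamma>)"
  unfolding bplus_def by (rule bclosed_Inter) simp

lemma bplus_extends: "M \<subseteq> bplus M \<Gamma>" and bplus_axioms: "\<Gamma> \<subseteq> bplus M \<Gamma>"
  unfolding bplus_def by blast+

lemma bplus_least: "bclosed N \<Longrightarrow> M \<subseteq> N \<Longrightarrow> \<Gamma> \<subseteq> N \<Longrightarrow> bplus M \<Gamma> \<subseteq> N"
  unfolding bplus_def by blast

lemma fusion_extends: "in_dia ` L \<subseteq> fusion_S5 L" "in_ex ` S5 \<subseteq> fusion_S5 L"
  unfolding fusion_S5_def by blast+

lemma dia_MLB: "in_dia ` L \<subseteq> MLB L"
  using fusion_extends(1) bplus_extends unfolding MLB_def by blast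

lemma monadic_logic_superset:
  assumes "MLB L \<subseteq> M" "bclosed M" "K_plus {} \<subseteq> L"
  shows "monadic_logic M"
proof
  have "{BEx (BDia (BVar 0)) \<rightarrow>\<^sub>B BDia (BEx (BVar 0)), BDia (BEx (BVar 0)) \<rightarrow>\<^sub>B BEx (BDia (BVar 0))} \<subseteq> MLB L"
    unfolding MLB_def by (rule bplus_axioms)
  then show "BEx (BDia (BVar 0)) \<rightarrow>\<^sub>B BDia (BEx (BVar 0)) \<in> M"
    "BDia (BEx (BVar 0)) \<rightarrow>\<^sub>B BEx (BDia (BVar 0)) \<in> M"
    using assms(1) by simp_all blast+
  show "in_dia ` K_plus {} \<subseteq> M" using dia_MLB[of L] assms(1,3) by blast
  show "in_ex ` S5 \<subseteq> M"
    using fusion_extends(2)[of L] bplus_extends assms(1) unfolding MLB_def by blast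
qed (rule assms(2))

lemma K_sub_GL: "K_plus {} \<subseteq> GL" and K_sub_Grz: "K_plus {} \<subseteq> Grz"
  unfolding GL_def Grz_def by (rule K_plus_mono)+

lemma predicate_modal_logic_qplus: "predicate_modal_logic (qplus Q \<Gamma>)"
  unfolding qplus_def by (rule predicate_modal_logic_Inter) simp

lemma qplus_extends: "Q \<subseteq> qplus Q \<Gamma>" and qplus_axioms: "\<Gamma> \<subseteq> qplus Q \<Gamma>"
  unfolding qplus_def by blast+

lemma qplus_least: "predicate_modal_logic R \<Longrightarrow> Q \<subseteq> R \<Longrightarrow> \<Gamma> \<subseteq> R \<Longrightarrow> qplus Q \<Gamma> \<subseteq> R"
  unfolding qplus_def by blast

lemma predicate_modal_logic_QLB: "predicate_modal_logic (QLB L)"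
  unfolding QLB_def by (rule predicate_modal_logic_Inter) simp

lemma QLB_extends: "in_pred ` L \<subseteq> QLB L" and barcan_QLB: "barcan \<in> QLB L"
  unfolding QLB_def by blast+

text \<open>One direction is reflexivity; for the other, \<open>ER\<close> exchanges an
  \<open>E\<close>-step with a following \<open>R\<close>-step, and transitivity merges the two
  \<open>R\<close>-steps. This absorbs the boxes that the Goedel translation puts directly under
  \<forall>.\<close>

lemma (in monadic_logic) Grz_box_all_box:
  assumes Grz: "in_dia ` Grz \<subseteq> M" and x: "mcs x"
  shows "BBox (BAll (BBox \<phi>)) \<in> x \<longleftrightarrow> BBox (BAll \<phi>) \<in> x"
proof
  assume *: "BBox (BAll (BBox \<phi>)) \<in> x"
  have "\<phi> \<in> z" if "R x y" "E y z" for y z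
    using * that mem_box[OF x] mem_all[OF R_mcs[OF that(1)]] mem_box[OF E_mcs[OF that(2)]]
      Grz_refl[OF Grz E_mcs[OF that(2)]] by blast
  then show "BBox (BAll \<phi>) \<in> x" using mem_box[OF x] mem_all[OF R_mcs] by blast
next
  assume *: "BBox (BAll \<phi>) \<in> x"
  have "\<phi> \<in> w" if yz: "R x y" "E y z" "R z w" for y z w
  proof -
    obtain v where v: "R y v" "E v w" using ER[OF R_mcs[OF yz(1)] yz(2,3)] .
    have "R x v" using Grz_trans[OF Grz x yz(1) v(1)] .
    then show ?thesis using * mem_box[OF x] mem_all[OF R_mcs[OF \<open>R x v\<close>]] v(2) by blast
  qed
  then have "BBox \<phi> \<in> z" if "R x y" "E y z" for y z
    using that mem_box[OF E_mcs[OF that(2)]] by blast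
  then show "BBox (BAll (BBox \<phi>)) \<in> x" using mem_box[OF x] mem_all[OF R_mcs] by blast
qed

text \<open>Differs from \<open>casari_axiom\<close> by a box directly under each \<forall> and one
  in front of the whole.\<close>

definition goedel_casari :: "bfm \<Rightarrow> bfm" where
  "goedel_casari p = BBox (BBox (BAll (BBox (BBox (BBox p \<rightarrow>\<^sub>B BBox (BAll (BBox p))) \<rightarrow>\<^sub>B BBox (BAll (BBox p)))))
     \<rightarrow>\<^sub>B BBox (BAll (BBox p)))"

lemma one_var_goedel_casari: "one_var 0 id (goedel_casari (BVar 0)) = goedel casari"
  by (simp add: goedel_casari_def casari_def Let_def)

text \<open>Equivalent subformulas are exchanged from the inside out at the points of the canonical
  model, and reflexivity removes the outermost box.\<close>

lemma (in monadic_logic) casari_axiom_goedel: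
  assumes Grz: "in_dia ` Grz \<subseteq> M" and gc: "goedel_casari p \<in> M"
  shows "casari_axiom p \<in> M"
  unfolding M_iff
proof (intro allI impI)
  fix x assume x: "mcs x"
  let ?A = "BBox (BAll (BBox p))" and ?B = "BBox (BAll p)"
  let ?a = "BBox (BBox p \<rightarrow>\<^sub>B ?A) \<rightarrow>\<^sub>B ?A" and ?b = "BBox (BBox p \<rightarrow>\<^sub>B ?B) \<rightarrow>\<^sub>B ?B"
  have AB: "?A \<in> y \<longleftrightarrow> ?B \<in> y" if "mcs y" for y using Grz_box_all_box[OF Grz that] .
  have "(BBox p \<rightarrow>\<^sub>B ?A) \<in> y \<longleftrightarrow> (BBox p \<rightarrow>\<^sub>B ?B) \<in> y" if "mcs y" for y
    unfolding mcs_imp[OF that, of "BBox p"] AB[OF that] ..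
  then have "BBox (BBox p \<rightarrow>\<^sub>B ?A) \<in> y \<longleftrightarrow> BBox (BBox p \<rightarrow>\<^sub>B ?B) \<in> y" if "mcs y" for y
    unfolding mem_box[OF that] using R_mcs by blast
  then have ab: "?a \<in> y \<longleftrightarrow> ?b \<in> y" if "mcs y" for y
    unfolding mcs_imp[OF that, of "BBox _"] using AB that by blast
  have "BBox (BAll ?a) \<in> x \<longleftrightarrow> BBox (BAll ?b) \<in> x"
    unfolding mem_box[OF x] using mem_all[OF R_mcs] ab[OF E_mcs] by blast
  then have "BBox (BAll (BBox ?a)) \<in> x \<longleftrightarrow> BBox (BAll ?b) \<in> x"
    unfolding Grz_box_all_box[OF Grz x] .
  moreover have "(BBox (BAll (BBox ?a)) \<rightarrow>\<^sub>B ?A) \<in> x"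
    using mcs_M[OF x gc[unfolded goedel_casari_def]] mem_box[OF x] Grz_refl[OF Grz x] by blast
  ultimately have "BBox (BAll ?b) \<in> x \<longrightarrow> ?B \<in> x"
    unfolding mcs_imp[OF x, of "BBox (BAll (BBox ?a))"] AB[OF x] by blast
  then show "casari_axiom p \<in> x"
    unfolding casari_axiom_def mcs_imp[OF x, of "BBox (BAll ?b)"] .
qed

section \<open>Soundness\<close>

lemma MpGrzB_sound:
  assumes "inj l"
  shows "MpGrzB \<subseteq> {\<phi>. one_var x l \<phi> \<in> QpGrzB}" (is "_ \<subseteq> ?M")
proof -
  interpret Q: pml QpGrzB
    by (simp add: pml_def QpGrzB_def predicate_modal_logic_qplus)
  have ext: "QLB Grz \<subseteq> QpGrzB" unfolding QpGrzB_def QGrzB_def by (rule qplus_extends)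
  then have M: "MLB Grz \<subseteq> ?M"
    using QLB_extends[of Grz] barcan_QLB[of Grz] by (intro Q.one_var_MLB[OF assms]) blast+
  have closed: "bclosed ?M" by (rule Q.one_var_bclosed[OF assms])
  \<comment> \<open>The formulas translated into \<open>QpGrzB\<close> form a monadic logic
    themselves. Its canonical model replaces a derivation in the predicate calculus when the Goedel
    translation is simplified.\<close>
  interpret monadic_logic ?M
    by (rule monadic_logic_superset[OF M closed K_sub_Grz])
  have "goedel casari \<in> QpGrzB" unfolding QpGrzB_def using qplus_axioms by blast
  then have "one_var 0 id (goedel_casari (BVar 0)) \<in> QpGrzB" by (simp only: one_var_goedel_casari)
  \<comment> \<open>The identity substitution serves to pass from variable 0 and letters
    \<open>id\<close> to \<open>x\<close> and \<open>l\<close>.\<close>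
  then have "one_var x l (bsubst BVar (goedel_casari (BVar 0))) \<in> QpGrzB" by (rule Q.one_var_instance)
  then have "goedel_casari (BVar 0) \<in> ?M" by (simp add: goedel_casari_def)
  then have "casari_axiom (BVar 0) \<in> ?M"
    using casari_axiom_goedel dia_MLB[of Grz] M by blast
  then show ?thesis
    unfolding MpGrzB_def MGrzB_def
    by (intro bplus_least closed M) (simp add: casari_axiom_def)
qed

lemma MGLB_sound:
  assumes "inj l"
  shows "MGLB \<subseteq> {\<phi>. one_var x l \<phi> \<in> QGLB}"
proof -
  interpret Q: pml QGLB
    by (simp add: pml_def QGLB_def predicate_modal_logic_QLB)
  show ?thesis
    unfolding MGLB_def
    by (rule Q.one_var_MLB[OF assms]) (simp_all add: QGLB_def QLB_extends barcan_QLB)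
qed

lemma bdepth_sound:
  assumes "inj l" and "M \<subseteq> {\<phi>. one_var x l \<phi> \<in> Q}"
  shows "bdepth M n \<subseteq> {\<phi>. one_var x l \<phi> \<in> qdepth Q n}" (is "_ \<subseteq> ?M")
proof -
  interpret Q: pml "qdepth Q n"
    by (simp add: pml_def qdepth_def predicate_modal_logic_qplus)
  have "in_pred (bd n) \<in> qdepth Q n" unfolding qdepth_def using qplus_axioms by blast
  moreover have "Q \<subseteq> qdepth Q n" unfolding qdepth_def by (rule qplus_extends)
  ultimately show ?thesis
    unfolding bdepth_def
    using assms(2) by (intro bplus_least Q.one_var_bclosed[OF assms(1)]) (auto intro: Q.one_var_in_dia)
qed

section \<open>Completeness\<close>

context monadic_logic
begin

text \<open>The number \<open>N\<close> of rounds also bounds the depth of the frame, so one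
  countermodel serves both \<open>QGLB\<close> and its extension by \<open>bd N\<close>.\<close>

lemma GL_countermodel:
  assumes "inj l" and GL: "in_dia ` GL \<subseteq> M" and "\<phi> \<notin> M"
    and N: "\<And>x. mcs x \<Longrightarrow> types (sub \<phi>) x \<in> (repairable False (sub \<phi>) ^^ N) {}"
  shows "one_var x l \<phi> \<notin> QGLB" and "one_var x l \<phi> \<notin> qdepth QGLB N"
proof -
  interpret F: ranked_frame "worlds False (sub \<phi>) N" "above False (sub \<phi>) N" fst
    by (rule ranked_frame_worlds)
  let ?V = "valid (worlds False (sub \<phi>) N) (F.R False)"
  have "one_var x l \<phi> \<notin> ?V" by (rule countermodel[OF assms(1) _ N assms(3)]) simp
  moreover have Q: "QGLB \<subseteq> ?V" unfolding QGLB_def by (rule QLB_valid[OF F.R_W F.GL_valid])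
  moreover have "in_pred (bd N) \<in> ?V" using in_pred_valid[OF F.bd_valid] worlds_rank by blast
  then have "qdepth QGLB N \<subseteq> ?V"
    unfolding qdepth_def using Q by (intro qplus_least predicate_modal_logic_valid[OF F.R_W]) auto
  ultimately show "one_var x l \<phi> \<notin> QGLB" and "one_var x l \<phi> \<notin> qdepth QGLB N" by blast+
qed

lemma Grz_countermodel:
  assumes "inj l" and Grz: "in_dia ` Grz \<subseteq> M" and "\<phi> \<notin> M"
    and N: "\<And>x. mcs x \<Longrightarrow> types (sub \<phi>) x \<in> (repairable True (sub \<phi>) ^^ N) {}"
  shows "one_var x l \<phi> \<notin> QpGrzB" and "one_var x l \<phi> \<notin> qdepth QpGrzB N"
proof -
  interpret F: ranked_frame "worlds True (sub \<phi>) N" "above True (sub \<phi>) N" fst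
    by (rule ranked_frame_worlds)
  let ?V = "valid (worlds True (sub \<phi>) N) (F.R True)"
  have "one_var x l \<phi> \<notin> ?V" by (rule countermodel[OF assms(1) _ N assms(3)]) (simp add: Grz_refl[OF Grz])
  moreover have "predicate_modal_logic ?V" by (rule predicate_modal_logic_valid[OF F.R_W])
  then have Q: "QpGrzB \<subseteq> ?V"
    unfolding QpGrzB_def QGrzB_def
    using QLB_valid[OF F.R_W F.Grz_valid] F.casari_valid by (intro qplus_least) auto
  moreover have "in_pred (bd N) \<in> ?V" using in_pred_valid[OF F.bd_valid] worlds_rank by blast
  then have "qdepth QpGrzB N \<subseteq> ?V"
    unfolding qdepth_def using Q by (intro qplus_least predicate_modal_logic_valid[OF F.R_W]) auto
  ultimately show "one_var x l \<phi> \<notin> QpGrzB" and "one_var x l \<phi> \<notin> qdepth QpGrzB N" by blast+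
qed

end

lemma sub_dia_all: "\<forall>\<psi>. BDia \<psi> \<in> sub \<phi> \<longrightarrow> \<psi> \<in> sub \<phi>"
  using sub_dia by blast

lemma bdepth_facts: "M \<subseteq> bdepth M n" "in_dia (bd n) \<in> bdepth M n" "bclosed (bdepth M n)"
  unfolding bdepth_def using bplus_extends bplus_axioms bclosed_bplus by blast+

lemma MGLB_complete:
  assumes "inj l" "\<phi> \<notin> MGLB"
  shows "one_var x l \<phi> \<notin> QGLB"
proof -
  have "bclosed MGLB" unfolding MGLB_def MLB_def by (rule bclosed_bplus)
  then interpret monadic_logic MGLB
    by (intro monadic_logic_superset[OF _ _ K_sub_GL]) (simp_all add: MGLB_def)
  have GL: "in_dia ` GL \<subseteq> MGLB" unfolding MGLB_def by (rule dia_MLB)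
  obtain N where "\<forall>x. mcs x \<longrightarrow> types (sub \<phi>) x \<in> (repairable False (sub \<phi>) ^^ N) {}"
    using unbounded[OF progress_GL[OF GL] finite_sub sub_dia_all] GL_trans[OF GL] by blast
  then show ?thesis using GL_countermodel(1)[OF assms(1) GL assms(2), of N] by blast
qed

text \<open>The frame has to validate \<open>bd n\<close>, so its ranks must not exceed
  \<open>n\<close>; \<open>bounded\<close> exhausts the canonical classes within \<open>n\<close>
  rounds.\<close>

lemma MGLB_bdepth_complete:
  assumes "inj l" "1 \<le> n" "\<phi> \<notin> bdepth MGLB n"
  shows "one_var x l \<phi> \<notin> qdepth QGLB n"
proof -
  have sub: "MLB GL \<subseteq> bdepth MGLB n" using bdepth_facts(1) unfolding MGLB_def .
  interpret monadic_logic "bdepth MGLB n"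
    by (rule monadic_logic_superset[OF sub bdepth_facts(3) K_sub_GL])
  have GL: "in_dia ` GL \<subseteq> bdepth MGLB n" using sub dia_MLB by blast
  have "\<forall>x y z. mcs x \<longrightarrow> R x y \<longrightarrow> R y z \<longrightarrow> R x z" using GL_trans[OF GL] by blast
  then have "types (sub \<phi>) y \<in> (repairable False (sub \<phi>) ^^ n) {}" if "mcs y" for y
    using bounded[OF progress_GL[OF GL] finite_sub sub_dia_all _ assms(2) bdepth_facts(2) that] by blast
  then show ?thesis using GL_countermodel(2)[OF assms(1) GL assms(3), of n] by blast
qed

lemma MpGrzB_facts: "MLB Grz \<subseteq> MpGrzB" "casari_axiom (BVar 0) \<in> MpGrzB" "bclosed MpGrzB"
proof -
  show "MLB Grz \<subseteq> MpGrzB" unfolding MpGrzB_def MGrzB_def by (rule bplus_extends)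
  show "casari_axiom (BVar 0) \<in> MpGrzB"
    unfolding MpGrzB_def casari_axiom_def using bplus_axioms by blast
  show "bclosed MpGrzB" unfolding MpGrzB_def by (rule bclosed_bplus)
qed

lemma MpGrzB_complete:
  assumes "inj l" "\<phi> \<notin> MpGrzB"
  shows "one_var x l \<phi> \<notin> QpGrzB"
proof -
  interpret monadic_logic MpGrzB
    by (rule monadic_logic_superset[OF MpGrzB_facts(1,3) K_sub_Grz])
  have Grz: "in_dia ` Grz \<subseteq> MpGrzB" using MpGrzB_facts(1) dia_MLB by blast
  obtain N where "\<forall>x. mcs x \<longrightarrow> types (sub \<phi>) x \<in> (repairable True (sub \<phi>) ^^ N) {}"
    using unbounded[OF progress_Grz[OF Grz MpGrzB_facts(2)] finite_sub sub_dia_all] Grz_trans[OF Grz]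
    by blast
  then show ?thesis using Grz_countermodel(1)[OF assms(1) Grz assms(2), of N] by blast
qed

lemma MpGrzB_bdepth_complete:
  assumes "inj l" "1 \<le> n" "\<phi> \<notin> bdepth MpGrzB n"
  shows "one_var x l \<phi> \<notin> qdepth QpGrzB n"
proof -
  have sub: "MLB Grz \<subseteq> bdepth MpGrzB n" and C: "casari_axiom (BVar 0) \<in> bdepth MpGrzB n"
    using bdepth_facts(1) MpGrzB_facts by blast+
  interpret monadic_logic "bdepth MpGrzB n"
    by (rule monadic_logic_superset[OF sub bdepth_facts(3) K_sub_Grz])
  have Grz: "in_dia ` Grz \<subseteq> bdepth MpGrzB n" using sub dia_MLB by blast
  have "\<forall>x y z. mcs x \<longrightarrow> R x y \<longrightarrow> R y z \<longrightarrow> R x z" using Grz_trans[OF Grz] by blast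
  then have "types (sub \<phi>) y \<in> (repairable True (sub \<phi>) ^^ n) {}" if "mcs y" for y
    using bounded[OF progress_Grz[OF Grz C] finite_sub sub_dia_all _ assms(2) bdepth_facts(2) that] by blast
  then show ?thesis using Grz_countermodel(2)[OF assms(1) Grz assms(3), of n] by blast
qed

lemma axiomatizesI:
  assumes "M \<subseteq> {\<phi>. one_var x l \<phi> \<in> Q}" and "\<And>\<phi>. \<phi> \<notin> M \<Longrightarrow> one_var x l \<phi> \<notin> Q"
  shows "axiomatizes_one_var_fragment x l M Q"
  using assms unfolding axiomatizes_one_var_fragment_def by blast

theorem theorem5p9:
  fixes n :: nat and x :: var and l :: "nat \<Rightarrow> nat"
  assumes "n \<ge> 1" and "inj l"
  shows "axiomatizes_one_var_fragment x l MpGrzB QpGrzB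
    \<and> axiomatizes_one_var_fragment x l MGLB QGLB
    \<and> axiomatizes_one_var_fragment x l (bdepth MpGrzB n) (qdepth QpGrzB n)
    \<and> axiomatizes_one_var_fragment x l (bdepth MGLB n) (qdepth QGLB n)"
  using assms
  by (intro conjI axiomatizesI MpGrzB_sound MGLB_sound bdepth_sound MpGrzB_complete MGLB_complete
      MpGrzB_bdepth_complete MGLB_bdepth_complete)

end
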